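(* Let $n\in\mathbb{N}$ and let $E\subsetneq\mathbb{R}^n$ be a nonempty set. Then there exists $\alpha>0$ such that the function $x\mapsto \operatorname{dist}(x,E)^{-\alpha}$ belongs to the Muckenhoupt class $A_1$ if and only if $E$ is weakly porous.
   Context: $\mathbb{N}=\{1,2,\dots\}$; $|\cdot|$ is $n$-dimensional Lebesgue measure; $\operatorname{dist}(x,E)$ is the Euclidean distance from $x$ to $E$. For $\alpha>0$, $\operatorname{dist}(x,E)^{-\alpha}$ is $+\infty$ where $\operatorname{dist}(x,E)=0$. Cubes: a cube is a half-open set $Q=[a_1,b_1)\times\cdots\times[a_n,b_n)$ with all sides of equal length $\ell(Q)=b_i-a_i>0$. For a cube $P$ and $j\ge 0$, $\mathcal{D}_j(P)$ is the collection of the $2^{jn}$ pairwise disjoint half-open cubes of side length $2^{-j}\ell(P)$ whose union is $P$, and $\mathcal{D}(P)=\bigcup_{j\ge0}\mathcal{D}_j(P)$ (the dyadic subcubes of $P$). Weak porosity: let $E\subset\mathbb{R}^n$ be nonempty. A cube $Q\in\mathcal{D}(P)$ is $E$-free if $E\cap Q=\emptyset$. $\mathcal{M}(P)\in\mathcal{D}(P)$ denotes a (fixed choice of a) largest $E$-free dyadic subcube of $P$, i.e. $\ell(\mathcal{M}(P))\ge\ell(R)$ for every $E$-free $R\in\mathcal{D}(P)$. $E$ is weakly porous if there are constants $0<c,\delta<1$ such that for every cube $P\subset\mathbb{R}^n$ there exist $N\in\mathbb{N}$ and pairwise disjoint $E$-free cubes $Q_1,\dots,Q_N\in\mathcal{D}(P)$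 with $|Q_k|\ge\delta|\mathcal{M}(P)|$ for all $k$ and $\sum_{k=1}^N|Q_k|\ge c|P|$ (in particular, every cube $P$ is required to have an $E$-free dyadic subcube). A weight is a locally integrable function $w$ on $\mathbb{R}^n$ with $w>0$ almost everywhere. A weight $w$ is in $A_1$ if there is a constant $C$ such that $\frac1{|Q|}\int_Q w\,dx\le C\operatorname{ess\,inf}_{Q}w$ for every cube $Q\subset\mathbb{R}^n$. A function that is not a weight does not belong to $A_1$. *)

theory Defs
  imports "HOL-Analysis.Analysis"
begin

section \<open>Half-open cubes and dyadic subcubes\<close>

definition hcube :: "real ^ 'n \<Rightarrow> real \<Rightarrow> (real ^ 'n) set" where
  "hcube a l = {x. \<forall>i. a $ i \<le> x $ i \<and> x $ i < a $ i + l}"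

definition is_cube :: "(real ^ 'n) set \<Rightarrow> bool" where
  "is_cube Q \<longleftrightarrow> (\<exists>a l. 0 < l \<and> Q = hcube a l)"

definition side_length :: "(real ^ 'n) set \<Rightarrow> real" where
  "side_length Q = (THE l. \<exists>a. 0 < l \<and> Q = hcube a l)"

text \<open>Level \<open>j\<close> is written as an explicit grid; the corner and side length of the cube \<open>P\<close> are
  determined by \<open>P\<close> (\<open>hcube_eq_iff\<close> below). The lemmas \<open>dyadic_level_card\<close>,
  \<open>dyadic_level_side\<close>, \<open>dyadic_level_disjoint\<close> and \<open>dyadic_level_Union\<close> show that these are the
  \<open>2^(j n)\<close> pairwise disjoint cubes of side length \<open>2^(-j)\<close> times that of \<open>P\<close>, with union \<open>P\<close>.\<close>

definition dyadic_level :: "nat \<Rightarrow> (real ^ 'n) set \<Rightarrow> (real ^ 'n) set set" where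
  "dyadic_level j P =
     {hcube (a + (l / 2 ^ j) *\<^sub>R (\<chi> i. real (k i))) (l / 2 ^ j) | a l (k :: 'n \<Rightarrow> nat).
        0 < l \<and> P = hcube a l \<and> (\<forall>i. k i < 2 ^ j)}"

definition dyadic_subcubes :: "(real ^ 'n) set \<Rightarrow> (real ^ 'n) set set" where
  "dyadic_subcubes P = (\<Union>j. dyadic_level j P)"

section \<open>Weak porosity\<close>

definition free_subcubes :: "(real ^ 'n) set \<Rightarrow> (real ^ 'n) set \<Rightarrow> (real ^ 'n) set set" where
  "free_subcubes E P = {Q \<in> dyadic_subcubes P. E \<inter> Q = {}}"

text \<open>A fixed choice of a largest \<open>E\<close>-free dyadic subcube; unspecified if \<open>P\<close> has no \<open>E\<close>-free
  dyadic subcube at all.\<close>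

definition max_free_subcube :: "(real ^ 'n) set \<Rightarrow> (real ^ 'n) set \<Rightarrow> (real ^ 'n) set" where
  "max_free_subcube E P =
     (SOME M. M \<in> free_subcubes E P \<and> (\<forall>R \<in> free_subcubes E P. side_length R \<le> side_length M))"

text \<open>Because \<open>N \<ge> 1\<close>, every cube is required to have an \<open>E\<close>-free dyadic subcube, so the
  unspecified case of \<open>max_free_subcube\<close> never satisfies the condition.\<close>

definition weakly_porous :: "(real ^ 'n) set \<Rightarrow> bool" where
  "weakly_porous E \<longleftrightarrow>
     (\<exists>c \<delta>. 0 < c \<and> c < 1 \<and> 0 < \<delta> \<and> \<delta> < 1 \<and>
        (\<forall>P. is_cube P \<longrightarrow>
           (\<exists>(N :: nat) Q. 1 \<le> N \<and>
              (\<forall>k \<in> {1..N}. Q k \<in> free_subcubes E P) \<and>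
              disjoint_family_on Q {1..N} \<and>
              (\<forall>k \<in> {1..N}. measure lebesgue (Q k) \<ge> \<delta> * measure lebesgue (max_free_subcube E P)) \<and>
              (\<Sum>k = 1..N. measure lebesgue (Q k)) \<ge> c * measure lebesgue P)))"

section \<open>Weights and the class \<open>A\<^sub>1\<close>\<close>

text \<open>Weights take values in \<open>[0, \<infinity>]\<close>, so that negative powers of a distance are admissible
  functions.\<close>

definition locally_integrable :: "(real ^ 'n \<Rightarrow> ennreal) \<Rightarrow> bool" where
  "locally_integrable w \<longleftrightarrow> w \<in> borel_measurable lebesgue \<and>
     (\<forall>K. compact K \<longrightarrow> (\<integral>\<^sup>+x\<in>K. w x \<partial>lebesgue) < \<infinity>)"

definition weight :: "(real ^ 'n \<Rightarrow> ennreal) \<Rightarrow> bool" where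
  "weight w \<longleftrightarrow> locally_integrable w \<and> (AE x in lebesgue. 0 < w x)"

definition ess_inf_on :: "(real ^ 'n) set \<Rightarrow> (real ^ 'n \<Rightarrow> ennreal) \<Rightarrow> ennreal" where
  "ess_inf_on Q w = Sup {z. AE x in lebesgue. x \<in> Q \<longrightarrow> z \<le> w x}"

definition muckenhoupt_A1 :: "(real ^ 'n \<Rightarrow> ennreal) \<Rightarrow> bool" where
  "muckenhoupt_A1 w \<longleftrightarrow> weight w \<and>
     (\<exists>C::real. 0 \<le> C \<and>
        (\<forall>Q. is_cube Q \<longrightarrow>
           (\<integral>\<^sup>+x\<in>Q. w x \<partial>lebesgue) / emeasure lebesgue Q \<le> ennreal C * ess_inf_on Q w))"

definition dist_neg_power :: "(real ^ 'n) set \<Rightarrow> real \<Rightarrow> real ^ 'n \<Rightarrow> ennreal" where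
  "dist_neg_power E \<alpha> x =
     (if infdist x E = 0 then \<infinity> else ennreal (infdist x E powr (- \<alpha>)))"

section \<open>Basic facts about the dyadic grid\<close>

lemma hcube_subset_imp:
  fixes a b :: "real ^ 'n"
  assumes "0 < l" and sub: "hcube a l \<subseteq> hcube b m"
  shows "b $ i \<le> a $ i" and "a $ i + l \<le> b $ i + m"
proof -
  have "a \<in> hcube a l" using assms(1) by (simp add: hcube_def)
  then have a: "a \<in> hcube b m" using sub by blast
  then show "b $ i \<le> a $ i" by (simp add: hcube_def)
  show "a $ i + l \<le> b $ i + m"
  proof (rule ccontr)
    assume *: "\<not> a $ i + l \<le> b $ i + m"
    define t where "t = b $ i + m - a $ i"
    have t: "0 < t" "t < l" using a * by (auto simp: t_def hcube_def)
    have "(\<chi> j. a $ j + t) \<in> hcube a l" using t by (simp add: hcube_def)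
    then have "(\<chi> j. a $ j + t) \<in> hcube b m" using sub by blast
    then have "a $ i + t < b $ i + m" by (simp add: hcube_def)
    then show False by (simp add: t_def)
  qed
qed

lemma hcube_eq_iff:
  fixes a b :: "real ^ 'n"
  assumes "0 < l" "0 < m"
  shows "hcube a l = hcube b m \<longleftrightarrow> a = b \<and> l = m"
proof
  assume eq: "hcube a l = hcube b m"
  have *: "b $ i = a $ i \<and> a $ i + l = b $ i + m" for i
    using hcube_subset_imp[OF assms(1), of a b m i] hcube_subset_imp[OF assms(2), of b a l i] eq
    by fastforce
  then have "a = b" by (simp add: vec_eq_iff)
  moreover from this have "l = m" using *[of undefined] by simp
  ultimately show "a = b \<and> l = m" ..
qed simp

lemma side_length_hcube: "0 < l \<Longrightarrow> side_length (hcube a l) = l"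
  unfolding side_length_def by (rule the_equality) (auto simp: hcube_eq_iff)

lemma dyadic_level_hcube:
  fixes a :: "real ^ 'n"
  assumes "0 < l"
  shows "dyadic_level j (hcube a l) =
    (\<lambda>k. hcube (a + (l / 2 ^ j) *\<^sub>R (\<chi> i. real (k i))) (l / 2 ^ j)) ` {k. \<forall>i. k i < 2 ^ j}"
  using assms by (auto simp: dyadic_level_def hcube_eq_iff)

lemma dyadic_level_side:
  assumes "Q \<in> dyadic_level j P"
  shows "is_cube Q" "side_length Q = side_length P / 2 ^ j"
proof -
  obtain a l k where "0 < l" "P = hcube a l"
    "Q = hcube (a + (l / 2 ^ j) *\<^sub>R (\<chi> i. real (k i))) (l / 2 ^ j)"
    using assms unfolding dyadic_level_def by blast
  moreover from this have "0 < l / 2 ^ j" by simp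
  ultimately show "is_cube Q" "side_length Q = side_length P / 2 ^ j"
    unfolding is_cube_def by (blast, simp add: side_length_hcube)
qed

lemma mem_grid_cube_iff:
  fixes a x :: "real ^ 'n"
  assumes "0 < h"
  shows "x \<in> hcube (a + h *\<^sub>R (\<chi> i. real (k i))) h \<longleftrightarrow>
    (\<forall>i. \<lfloor>(x $ i - a $ i) / h\<rfloor> = int (k i))"
  using assms by (simp add: hcube_def floor_eq_iff field_simps)

lemma dyadic_level_disjoint: "disjoint (dyadic_level j P)"
proof (rule disjointI)
  fix Q R assume QR: "Q \<in> dyadic_level j P" "R \<in> dyadic_level j P" "Q \<noteq> R"
  then obtain a l where P: "0 < l" "P = hcube a l" unfolding dyadic_level_def by blast
  then have h: "0 < l / 2 ^ j" by simp
  obtain k k' where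
    Q: "Q = hcube (a + (l / 2 ^ j) *\<^sub>R (\<chi> i. real (k i))) (l / 2 ^ j)" and
    R: "R = hcube (a + (l / 2 ^ j) *\<^sub>R (\<chi> i. real (k' i))) (l / 2 ^ j)"
    using QR P by (auto simp: dyadic_level_hcube)
  show "Q \<inter> R = {}"
  proof (rule ccontr)
    assume "Q \<inter> R \<noteq> {}"
    then obtain x where "x \<in> Q" "x \<in> R" by blast
    then have "int (k i) = int (k' i)" for i
      unfolding Q R mem_grid_cube_iff[OF h] by metis
    then have "k = k'" by auto
    then show False using QR(3) Q R by simp
  qed
qed

lemma dyadic_level_Union:
  assumes "is_cube P"
  shows "\<Union> (dyadic_level j P) = P"
proof -
  obtain a l where P: "0 < l" "P = hcube a l" using assms unfolding is_cube_def by blast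
  define h where "h = l / 2 ^ j"
  have h: "0 < h" "l = h * 2 ^ j" using P by (auto simp: h_def)
  have floor_lt: "\<lfloor>(x $ i - a $ i) / h\<rfloor> < 2 ^ j \<longleftrightarrow> x $ i < a $ i + l" for x i
    using h(1) by (simp add: floor_less_iff h(2) field_simps)
  have "x \<in> \<Union> (dyadic_level j P) \<longleftrightarrow> x \<in> P" for x
  proof
    assume "x \<in> \<Union> (dyadic_level j P)"
    then obtain k where k: "\<And>i. k i < 2 ^ j" and "x \<in> hcube (a + h *\<^sub>R (\<chi> i. real (k i))) h"
      unfolding P(2) dyadic_level_hcube[OF P(1)] h_def by blast
    then have f: "\<lfloor>(x $ i - a $ i) / h\<rfloor> = int (k i)" for i
      using mem_grid_cube_iff[OF h(1)] by blast
    have "a $ i \<le> x $ i \<and> x $ i < a $ i + l" for i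
    proof
      have "0 \<le> \<lfloor>(x $ i - a $ i) / h\<rfloor>" by (simp add: f)
      then show "a $ i \<le> x $ i" using h(1) by (simp add: zero_le_divide_iff)
      have "int (k i) < 2 ^ j" using k[of i] by (metis of_nat_less_iff of_nat_numeral of_nat_power)
      then show "x $ i < a $ i + l" using floor_lt[of x i] f[of i] by simp
    qed
    then show "x \<in> P" by (simp add: P(2) hcube_def)
  next
    assume "x \<in> P"
    then have x: "a $ i \<le> x $ i" "x $ i < a $ i + l" for i by (auto simp: P(2) hcube_def)
    define k where "k i = nat \<lfloor>(x $ i - a $ i) / h\<rfloor>" for i
    have f: "\<lfloor>(x $ i - a $ i) / h\<rfloor> = int (k i)" for i
      using x(1)[of i] h(1) by (simp add: k_def)
    have "x \<in> hcube (a + h *\<^sub>R (\<chi> i. real (k i))) h" using f mem_grid_cube_iff[OF h(1)] by blast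
    moreover have "k i < 2 ^ j" for i
    proof -
      have "int (k i) < 2 ^ j" using floor_lt[of x i] f[of i] x(2)[of i] by simp
      then show ?thesis by (metis of_nat_less_iff of_nat_numeral of_nat_power)
    qed
    ultimately show "x \<in> \<Union> (dyadic_level j P)"
      unfolding P(2) dyadic_level_hcube[OF P(1)] h_def by blast
  qed
  then show ?thesis by blast
qed

lemma dyadic_level_card:
  fixes P :: "(real ^ 'n) set"
  assumes "is_cube P"
  shows "card (dyadic_level j P) = 2 ^ (j * CARD('n))"
proof -
  obtain a l where P: "0 < l" "P = hcube a l" using assms unfolding is_cube_def by blast
  then have h: "0 < l / 2 ^ j" by simp
  have "inj_on (\<lambda>k. hcube (a + (l / 2 ^ j) *\<^sub>R (\<chi> i. real (k i))) (l / 2 ^ j))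
          {k :: 'n \<Rightarrow> nat. \<forall>i. k i < 2 ^ j}"
    using P(1) by (auto intro!: inj_onI simp: hcube_eq_iff[OF h h] vec_eq_iff)
  then have "card (dyadic_level j P) = card {k :: 'n \<Rightarrow> nat. \<forall>i. k i < 2 ^ j}"
    unfolding P(2) dyadic_level_hcube[OF P(1)] by (rule card_image)
  also have "{k :: 'n \<Rightarrow> nat. \<forall>i. k i < 2 ^ j} = PiE UNIV (\<lambda>_. {..<2 ^ j})"
    by (auto simp: PiE_def)
  also have "card \<dots> = 2 ^ (j * CARD('n))"
    by (simp add: card_PiE power_mult)
  finally show ?thesis .
qed

end

theory Submission
  imports Defs
begin

text \<open>
  Write \<open>n\<close> for the dimension and \<open>S(P)\<close> for the supremum of \<open>dist(x, E)\<close> over a cube \<open>P\<close>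
  (\<open>max_dist\<close>). Both sides of the equivalence say that on every cube \<open>P\<close> the distance is comparable
  with \<open>S(P)\<close> on a fixed proportion of \<open>P\<close>:
  \<open>S(P) > 0\<close> and \<open>|{x \<in> P. dist(x, E) \<ge> \<kappa> S(P)}| \<ge> c |P|\<close> for constants \<open>c, \<kappa> > 0\<close>
  (\<open>mostly_distant\<close>).

  For weak porosity this is a translation. A free cube has points whose distance to \<open>E\<close> is comparable
  with its side, and a point at distance \<open>d\<close> lies in free dyadic cubes of side comparable with \<open>d\<close>, as far as
  \<open>P\<close> has cubes of this size. So \<open>S(P)\<close> plays the role of the side of the largest free subcube
  (\<open>weakly_porous_imp_mostly_distant\<close>, \<open>mostly_distant_imp_weakly_porous\<close>).

  For the Muckenhoupt condition, the essential infimum of \<open>dist(x, E)\<^sup>-\<^sup>\<alpha>\<close> over \<open>P\<close> is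
  \<open>S(P)\<^sup>-\<^sup>\<alpha>\<close>. If the mean is bounded by a multiple of this, Chebyshev's inequality shows that the distance is
  rarely much smaller than \<open>S(P)\<close> (\<open>muckenhoupt_imp_mostly_distant\<close>).

  The substantial direction is the converse, where the mean of \<open>dist(x, E)\<^sup>-\<^sup>\<alpha>\<close> has to be bounded by
  a multiple of \<open>S(P)\<^sup>-\<^sup>\<alpha>\<close>. The condition on one cube says nothing about how the distance behaves where it
  is small, so it has to be iterated on smaller cubes, and for this \<open>S\<close> must not drop too much from a
  cube to its children. This doubling property (\<open>mostly_distant_doubling\<close>) holds because a cube that fills more than the
  proportion \<open>1 - c\<close> of a larger cube contains one of the distant points of the larger one. A
  stopping-time argument (\<open>measure_sublevel_le\<close>) then gives the geometric decay
  \<open>|{x \<in> P. dist(x, E) \<le> \<theta>\<^sup>m S(P)}| \<le> (1 - c)\<^sup>m |P|\<close> (\<open>mostly_distant_level_set_decay\<close>), and for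
  small \<open>\<alpha>\<close> the integral of \<open>dist(x, E)\<^sup>-\<^sup>\<alpha>\<close> is bounded by a convergent geometric series
  (\<open>nn_integral_dist_neg_power_le\<close>).
\<close>

section \<open>Half-open cubes\<close>

lemma is_cube_hcube: "0 < l \<Longrightarrow> is_cube (hcube a l)"
  by (auto simp: is_cube_def)

lemma sets_hcube: "hcube a l \<in> sets borel"
  unfolding hcube_def by measurable

lemma hcube_subset_cbox: "hcube a l \<subseteq> cbox a (\<chi> i. a $ i + l)"
  by (auto simp: hcube_def mem_box_cart less_imp_le)

lemma lmeasurable_hcube [simp]: "hcube a l \<in> lmeasurable"
proof (rule fmeasurableI2[OF lmeasurable_cbox hcube_subset_cbox])
  have "hcube a l \<in> sets lborel" by (simp add: sets_hcube)
  then show "hcube a l \<in> sets lebesgue" by (rule sets_completionI_sets)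
qed

lemma sets_lebesgue_hcube [simp]: "hcube a l \<in> sets lebesgue"
  by (simp add: fmeasurableD)

lemma measure_hcube:
  fixes a :: "real ^ 'n"
  assumes "0 < l"
  shows "measure lebesgue (hcube a l) = l ^ CARD('n)"
proof -
  let ?b = "\<chi> i. a $ i + l"
  have ne: "cbox a ?b \<noteq> {}" using assms by (auto simp: interval_ne_empty_cart)
  have "box a ?b \<subseteq> hcube a l" by (auto simp: hcube_def mem_box_cart less_imp_le)
  then have "measure lebesgue (box a ?b) \<le> measure lebesgue (hcube a l)"
    by (intro measure_mono_fmeasurable) auto
  moreover have "measure lebesgue (hcube a l) \<le> measure lebesgue (cbox a ?b)"
    by (intro measure_mono_fmeasurable hcube_subset_cbox fmeasurableD) auto
  moreover have "measure lebesgue (box a ?b) = measure lebesgue (cbox a ?b)"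
    using emeasure_lborel_box_eq[of a ?b] emeasure_lborel_cbox_eq[of a ?b]
    by (simp add: measure_def)
  moreover have "measure lebesgue (cbox a ?b) = l ^ CARD('n)"
    using content_cbox_cart[OF ne] by simp
  ultimately show ?thesis by linarith
qed

lemma emeasure_hcube:
  fixes a :: "real ^ 'n"
  assumes "0 < l"
  shows "emeasure lebesgue (hcube a l) = ennreal (l ^ CARD('n))"
  using measure_hcube[OF assms, of a] by (simp add: emeasure_eq_measure2)

lemma dist_hcube_le:
  fixes a :: "real ^ 'n"
  assumes "x \<in> hcube a l" "y \<in> hcube a l"
  shows "dist x y \<le> real CARD('n) * l"
proof -
  have "\<bar>(x - y) $ i\<bar> \<le> l" for i
  proof -
    have "a $ i \<le> x $ i" "x $ i < a $ i + l" "a $ i \<le> y $ i" "y $ i < a $ i + l"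
      using assms by (auto simp: hcube_def)
    then show ?thesis by (simp add: abs_le_iff)
  qed
  then have "(\<Sum>i\<in>UNIV. \<bar>(x - y) $ i\<bar>) \<le> (\<Sum>i\<in>(UNIV::'n set). l)" by (intro sum_mono)
  with norm_le_l1_cart[of "x - y"] show ?thesis by (simp add: dist_norm)
qed

text \<open>A free cube keeps the points of its concentric half-size cube a quarter of the side away from \<open>E\<close>:
  a point of \<open>E\<close> closer than that would agree with them up to a quarter of the side in every
  coordinate, hence lie in the free cube.\<close>

lemma infdist_free_hcube:
  fixes E :: "(real ^ 'n) set"
  assumes "E \<noteq> {}" "E \<inter> hcube b s = {}" "x \<in> hcube (b + (s / 4) *\<^sub>R 1) (s / 2)"
  shows "s / 4 \<le> infdist x E"
proof -
  have "s / 4 \<le> dist x y" if "y \<in> E" for y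
  proof (rule ccontr)
    assume "\<not> s / 4 \<le> dist x y"
    then have "\<bar>x $ i - y $ i\<bar> < s / 4" for i
      using component_le_norm_cart[of "x - y" i] by (simp add: dist_norm)
    moreover have "b $ i + s / 4 \<le> x $ i" "x $ i < b $ i + s / 4 + s / 2" for i
      using assms(3) by (auto simp: hcube_def)
    ultimately have *: "\<bar>x $ i - y $ i\<bar> < s / 4" "b $ i + s / 4 \<le> x $ i"
      "x $ i < b $ i + s / 4 + s / 2" for i by blast+
    have "b $ i \<le> y $ i \<and> y $ i < b $ i + s" for i
      using *[of i] by linarith
    then show False using assms(2) that by (auto simp: hcube_def)
  qed
  then show ?thesis unfolding infdist_notempty[OF assms(1)] by (rule cINF_greatest[OF assms(1)])
qed

lemma dyadic_subcube_at:
  fixes a :: "real ^ 'n"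
  assumes "0 < l" "x \<in> hcube a l"
  obtains b where "hcube b (l / 2 ^ j) \<in> dyadic_level j (hcube a l)" "x \<in> hcube b (l / 2 ^ j)"
    "hcube b (l / 2 ^ j) \<subseteq> hcube a l"
proof -
  have U: "\<Union> (dyadic_level j (hcube a l)) = hcube a l"
    using assms(1) by (intro dyadic_level_Union) (auto simp: is_cube_def)
  then obtain Q where Q: "Q \<in> dyadic_level j (hcube a l)" "x \<in> Q" using assms(2) by blast
  moreover obtain b where "Q = hcube b (l / 2 ^ j)"
    using Q(1) by (auto simp: dyadic_level_hcube[OF assms(1)])
  moreover have "Q \<subseteq> hcube a l" using U Q(1) by blast
  ultimately show ?thesis using that by blast
qed

lemma dyadic_levelE:
  assumes "0 < l" "Q \<in> dyadic_level j (hcube a l)"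
  obtains b where "Q = hcube b (l / 2 ^ j)"
  using assms by (auto simp: dyadic_level_hcube)

lemma dyadic_level_subset:
  assumes "0 < l" "Q \<in> dyadic_level j (hcube a l)"
  shows "Q \<subseteq> hcube a l"
  using dyadic_level_Union[of "hcube a l" j] assms by (auto simp: is_cube_def)

text \<open>A point of \<open>E\<close> in the cube would be closer to \<open>x\<close> than \<open>n\<close> times the side, which bounds the
  diameter. This is how distant points produce free cubes.\<close>

lemma free_if_distant:
  fixes E :: "(real ^ 'n) set"
  assumes "x \<in> hcube b s" "real CARD('n) * s < infdist x E"
  shows "E \<inter> hcube b s = {}"
  using infdist_le[of _ E x] dist_hcube_le[OF assms(1)] assms(2) by fastforce

lemma finite_dyadic_level: "0 < l \<Longrightarrow> finite (dyadic_level j (hcube a l))"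
  by (rule card_ge_0_finite, subst dyadic_level_card) (auto simp: is_cube_def)

lemma dyadic_level_lmeasurable: "0 < l \<Longrightarrow> Q \<in> dyadic_level j (hcube a l) \<Longrightarrow> Q \<in> lmeasurable"
  by (auto elim: dyadic_levelE)

section \<open>The largest distance to a set on a cube\<close>

definition max_dist :: "(real ^ 'n) set \<Rightarrow> (real ^ 'n) set \<Rightarrow> real" where
  "max_dist E P = (SUP x\<in>P. infdist x E)"

lemma infdist_hcube_le:
  fixes a :: "real ^ 'n"
  assumes "x \<in> hcube a l" "y \<in> hcube a l"
  shows "infdist x E \<le> infdist y E + real CARD('n) * l"
  using infdist_triangle[of x E y] dist_hcube_le[OF assms] by linarith

lemma bdd_above_infdist_hcube: "bdd_above ((\<lambda>x. infdist x E) ` hcube a l)"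
proof (cases "hcube a l = {}")
  case False
  then obtain y where "y \<in> hcube a l" by blast
  then show ?thesis by (auto intro!: bdd_aboveI2 dest: infdist_hcube_le)
qed simp

lemma infdist_le_max_dist: "x \<in> hcube a l \<Longrightarrow> infdist x E \<le> max_dist E (hcube a l)"
  unfolding max_dist_def using bdd_above_infdist_hcube by (rule cSUP_upper2) auto

lemma corner_in_hcube: "0 < l \<Longrightarrow> a \<in> hcube a l"
  by (simp add: hcube_def)

lemma max_dist_le_iff:
  "0 < l \<Longrightarrow> max_dist E (hcube a l) \<le> r \<longleftrightarrow> (\<forall>x\<in>hcube a l. infdist x E \<le> r)"
  unfolding max_dist_def using corner_in_hcube
  by (subst cSUP_le_iff) (auto intro: bdd_above_infdist_hcube)

lemma less_max_distE:
  assumes "0 < l" "r < max_dist E (hcube a l)"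
  obtains x where "x \<in> hcube a l" "r < infdist x E"
  using max_dist_le_iff[OF assms(1), of E a r] assms(2) by force

lemma max_dist_le_add:
  fixes a :: "real ^ 'n"
  assumes "0 < l" "x \<in> hcube a l"
  shows "max_dist E (hcube a l) \<le> infdist x E + real CARD('n) * l"
  using assms by (auto simp: max_dist_le_iff infdist_hcube_le)

lemma max_dist_free_hcube:
  fixes E :: "(real ^ 'n) set"
  assumes "E \<noteq> {}" "E \<inter> hcube b s = {}" "0 < s" "hcube b s \<subseteq> hcube a l"
  shows "s / 4 \<le> max_dist E (hcube a l)"
proof -
  let ?x = "b + (s / 4) *\<^sub>R 1"
  have "?x \<in> hcube ?x (s / 2)" "?x \<in> hcube b s" using assms(3) by (auto simp: hcube_def)
  then show ?thesis
    using infdist_free_hcube[OF assms(1,2)] infdist_le_max_dist[of ?x a l E] assms(4) by force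
qed

lemma lmeasurable_hcube_Collect:
  assumes "Measurable.pred borel p"
  shows "{x \<in> hcube a l. p x} \<in> lmeasurable"
proof (rule fmeasurableI2[OF lmeasurable_hcube])
  have "{x \<in> hcube a l. p x} \<in> sets borel"
    using sets.Int[OF sets_hcube, of "{x. p x}"] assms by (auto simp: pred_def Int_def)
  then show "{x \<in> hcube a l. p x} \<in> sets lebesgue" by (auto intro: sets_completionI_sets)
qed auto

lemma measurable_infdist [measurable]: "(\<lambda>x. infdist x E) \<in> borel_measurable borel"
  by (intro borel_measurable_continuous_onI continuous_on_infdist continuous_on_id)

lemma measure_hcube_Collect_compl:
  fixes a :: "real ^ 'n"
  assumes "0 < l"
  shows "measure lebesgue {x \<in> hcube a l. infdist x E < r}
      + measure lebesgue {x \<in> hcube a l. r \<le> infdist x E} = l ^ CARD('n)"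
proof -
  let ?A = "{x \<in> hcube a l. infdist x E < r}" and ?B = "{x \<in> hcube a l. r \<le> infdist x E}"
  have "?A \<in> lmeasurable" "?B \<in> lmeasurable"
    by (rule lmeasurable_hcube_Collect; measurable)+
  then have "measure lebesgue (?A \<union> ?B) = measure lebesgue ?A + measure lebesgue ?B"
    by (intro measure_Un_AE AE_I2) (auto simp: fmeasurableD)
  moreover have "?A \<union> ?B = hcube a l" by auto
  ultimately show ?thesis using measure_hcube[OF assms, of a] by simp
qed

text \<open>The common ground of the two sides of the theorem. The threshold is proportional to the largest
  distance on the cube itself, which makes the condition invariant under scaling and meaningful both
  for cubes that meet \<open>E\<close> and for cubes far away from it. Positivity of the largest distance says that
  \<open>E\<close> is nowhere dense.\<close>

definition mostly_distant :: "real \<Rightarrow> real \<Rightarrow> (real ^ 'n) set \<Rightarrow> bool" where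
  "mostly_distant c \<kappa> E \<longleftrightarrow> (\<forall>a l. 0 < l \<longrightarrow> 0 < max_dist E (hcube a l) \<and>
     c * l ^ CARD('n)
       \<le> measure lebesgue {x \<in> hcube a l. \<kappa> * max_dist E (hcube a l) \<le> infdist x E})"

section \<open>Weak porosity and the level sets of the distance\<close>

text \<open>Since the sides of dyadic subcubes are \<open>l / 2 ^ j\<close>, the largest free subcubes are those of the least
  level that has a free cube; so the maximum in the definition of \<open>max_free_subcube\<close> is attained as
  soon as there is a free subcube.\<close>

lemma max_free_subcube_hcube:
  assumes "0 < l" "free_subcubes E (hcube a l) \<noteq> {}"
  obtains b j where "max_free_subcube E (hcube a l) = hcube b (l / 2 ^ j)"
    "hcube b (l / 2 ^ j) \<subseteq> hcube a l" "E \<inter> hcube b (l / 2 ^ j) = {}"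
    "\<And>R i. R \<in> dyadic_level i (hcube a l) \<Longrightarrow> E \<inter> R = {} \<Longrightarrow> j \<le> i"
proof -
  let ?P = "hcube a l"
  have side: "side_length R = l / 2 ^ i" if "R \<in> dyadic_level i ?P" for R i
    using dyadic_level_side(2)[OF that] assms(1) by (simp add: side_length_hcube)
  define j0 where "j0 = (LEAST j. \<exists>R\<in>dyadic_level j ?P. E \<inter> R = {})"
  have ex: "\<exists>j. \<exists>R\<in>dyadic_level j ?P. E \<inter> R = {}"
    using assms(2) by (auto simp: free_subcubes_def dyadic_subcubes_def)
  then obtain R where R: "R \<in> dyadic_level j0 ?P" "E \<inter> R = {}"
    using LeastI_ex[OF ex] unfolding j0_def by blast
  have "side_length Q \<le> side_length R" if "Q \<in> free_subcubes E ?P" for Q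
  proof -
    obtain i where i: "Q \<in> dyadic_level i ?P" "E \<inter> Q = {}"
      using \<open>Q \<in> _\<close> by (auto simp: free_subcubes_def dyadic_subcubes_def)
    then have "j0 \<le> i" unfolding j0_def by (blast intro: Least_le)
    then show ?thesis using side[OF i(1)] side[OF R(1)] assms(1) by (simp add: frac_le)
  qed
  then have "\<exists>M. M \<in> free_subcubes E ?P \<and> (\<forall>Q\<in>free_subcubes E ?P. side_length Q \<le> side_length M)"
    using R by (auto simp: free_subcubes_def dyadic_subcubes_def)
  then have M: "max_free_subcube E ?P \<in> free_subcubes E ?P"
    "\<And>Q. Q \<in> free_subcubes E ?P \<Longrightarrow> side_length Q \<le> side_length (max_free_subcube E ?P)"
    using someI_ex[of "\<lambda>M. M \<in> free_subcubes E ?P \<and>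
      (\<forall>Q\<in>free_subcubes E ?P. side_length Q \<le> side_length M)"]
    unfolding max_free_subcube_def by blast+
  then obtain j where j: "max_free_subcube E ?P \<in> dyadic_level j ?P"
    "E \<inter> max_free_subcube E ?P = {}"
    by (auto simp: free_subcubes_def dyadic_subcubes_def)
  obtain b where b: "max_free_subcube E ?P = hcube b (l / 2 ^ j)"
    using dyadic_levelE[OF assms(1) j(1)] .
  have "j \<le> i" if "Q \<in> dyadic_level i ?P" "E \<inter> Q = {}" for Q i
  proof -
    have "Q \<in> free_subcubes E ?P"
      using that by (auto simp: free_subcubes_def dyadic_subcubes_def)
    then have "l / 2 ^ i \<le> l / 2 ^ j" using M(2) side[OF that(1)] side[OF j(1)] by metis
    then have "(2::real) ^ j \<le> 2 ^ i" using assms(1) by (simp add: field_simps)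
    then show ?thesis by simp
  qed
  then show ?thesis
    using that[of b j] b j dyadic_level_subset[OF assms(1) j(1)] by metis
qed

text \<open>The concentric half-size cubes of the free cubes \<open>Q\<^sub>k\<close> carry a fixed proportion of the measure of
  the \<open>Q\<^sub>k\<close>, and on them the distance is at least a quarter of the side of \<open>Q\<^sub>k\<close>. It remains to compare
  this side, or that of the largest free subcube, with the largest distance \<open>S\<close>. A cube of the level
  above the one of the largest free subcube meets \<open>E\<close>, even if it contains a point at distance more
  than \<open>S / 2\<close>, so its diameter is at least \<open>S / 2\<close>. If the whole cube is
  free there is no level above; then either its side is comparable with \<open>S\<close>, or its diameter is at
  most \<open>S / 2\<close> and the distance is at least \<open>S / 2\<close> throughout.\<close>

lemma weakly_porous_imp_mostly_distant:
  fixes E :: "(real ^ 'n) set"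
  assumes "E \<noteq> {}" "weakly_porous E"
  obtains c \<kappa> where "0 < c" "c < 1" "0 < \<kappa>" "\<kappa> < 1" "mostly_distant c \<kappa> E"
proof -
  obtain c \<delta> where c: "0 < c" "c < 1" and \<delta>: "0 < \<delta>" "\<delta> < 1" and
    wp: "\<And>P. is_cube P \<Longrightarrow> \<exists>(N :: nat) Q. 1 \<le> N \<and>
              (\<forall>k \<in> {1..N}. Q k \<in> free_subcubes E P) \<and>
              disjoint_family_on Q {1..N} \<and>
              (\<forall>k \<in> {1..N}. measure lebesgue (Q k) \<ge> \<delta> * measure lebesgue (max_free_subcube E P)) \<and>
              (\<Sum>k = 1..N. measure lebesgue (Q k)) \<ge> c * measure lebesgue P"
    using assms(2) unfolding weakly_porous_def by blast
  let ?n = "CARD('n)"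
  have n: "0 < ?n" "1 \<le> real ?n" by (auto simp: Suc_leI)
  \<comment> \<open>One factor 4 comes from comparing \<open>S\<close> with the side of the largest free subcube, another one
    from the distance to \<open>E\<close> in the inner half of a free cube.\<close>
  define \<kappa> where "\<kappa> = \<delta> / (16 * real ?n)"
  have \<kappa>: "0 < \<kappa>" "\<kappa> < 1 / 2"
  proof -
    show "0 < \<kappa>" using \<delta> n by (simp add: \<kappa>_def)
    have "\<delta> < 1 / 2 * (16 * real ?n)" using \<delta> n(2) by linarith
    then show "\<kappa> < 1 / 2" using n by (simp add: \<kappa>_def pos_divide_less_eq)
  qed
  have "0 < max_dist E (hcube a l) \<and> c / 2 ^ ?n * l ^ ?n
      \<le> measure lebesgue {x \<in> hcube a l. \<kappa> * max_dist E (hcube a l) \<le> infdist x E}"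
    if l: "0 < l" for a l
  proof -
    let ?P = "hcube a l"
    define S where "S = max_dist E ?P"
    define G where "G = {x \<in> ?P. \<kappa> * S \<le> infdist x E}"
    have G_meas: "G \<in> lmeasurable" unfolding G_def by (rule lmeasurable_hcube_Collect) measurable
    obtain N :: nat and Q where N: "1 \<le> N" and Q: "\<And>k. k \<in> {1..N} \<Longrightarrow> Q k \<in> free_subcubes E ?P"
      and disj: "disjoint_family_on Q {1..N}"
      and big: "\<And>k. k \<in> {1..N} \<Longrightarrow> measure lebesgue (Q k) \<ge> \<delta> * measure lebesgue (max_free_subcube E ?P)"
      and total: "(\<Sum>k = 1..N. measure lebesgue (Q k)) \<ge> c * measure lebesgue ?P"
      using wp[OF is_cube_hcube[OF l, of a]]
      by blast
    have "Q 1 \<in> free_subcubes E ?P" using Q[of 1] N by simp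
    then obtain b j where M: "max_free_subcube E ?P = hcube b (l / 2 ^ j)"
      "hcube b (l / 2 ^ j) \<subseteq> ?P" "E \<inter> hcube b (l / 2 ^ j) = {}" and
      j: "\<And>R i. R \<in> dyadic_level i ?P \<Longrightarrow> E \<inter> R = {} \<Longrightarrow> j \<le> i"
      using max_free_subcube_hcube[OF l, of E a] by blast
    have S: "0 < S"
    proof -
      have "0 < l / 2 ^ j / 4" using l by simp
      also have "\<dots> \<le> S" unfolding S_def using l M by (intro max_dist_free_hcube assms) auto
      finally show ?thesis .
    qed
    have "c / 2 ^ ?n * l ^ ?n \<le> measure lebesgue G"
    proof (cases "real ?n * l \<le> S / 2")
      case True
      have "\<kappa> * S \<le> infdist x E" if "x \<in> ?P" for x
      proof -
        have "S / 2 \<le> infdist x E" using max_dist_le_add[OF l that, of E] True by (simp add: S_def)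
        moreover have "\<kappa> * S \<le> S / 2" using \<kappa> S by simp
        ultimately show ?thesis by linarith
      qed
      then have "G = ?P" by (auto simp: G_def)
      moreover have "c / 2 ^ ?n \<le> 1" using c by (simp add: divide_le_eq order_trans[OF _ one_le_power])
      ultimately show ?thesis
        using l mult_right_mono[of "c / 2 ^ ?n" 1 "l ^ ?n"] by (simp add: measure_hcube)
    next
      case False
      have M_side: "S \<le> 4 * real ?n * (l / 2 ^ j)"
      proof (rule ccontr)
        assume small: "\<not> S \<le> 4 * real ?n * (l / 2 ^ j)"
        have "j \<noteq> 0" using small False S by (intro notI) simp
        then obtain i where i: "j = Suc i" by (cases j) auto
        have lt: "real ?n * (l / 2 ^ i) < S / 2" using small i by (simp add: mult.commute mult.left_commute)
        obtain x where x: "x \<in> ?P" "S / 2 < infdist x E"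
          using less_max_distE[OF l, of "S / 2" E a] S by (auto simp: S_def)
        obtain b' where b': "hcube b' (l / 2 ^ i) \<in> dyadic_level i ?P" "x \<in> hcube b' (l / 2 ^ i)"
          using dyadic_subcube_at[OF l x(1)] by metis
        have "real ?n * (l / 2 ^ i) < infdist x E" using lt x(2) by linarith
        then have "E \<inter> hcube b' (l / 2 ^ i) = {}" by (rule free_if_distant[OF b'(2)])
        from j[OF b'(1) this] i show False by simp
      qed
      have piece: "measure lebesgue (Q k) / 2 ^ ?n \<le> measure lebesgue (G \<inter> Q k) \<and> Q k \<in> lmeasurable"
        if k: "k \<in> {1..N}" for k
      proof -
        obtain i where i: "Q k \<in> dyadic_level i ?P" and free: "E \<inter> Q k = {}"
          using Q[OF k] unfolding free_subcubes_def dyadic_subcubes_def by blast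
        define s where "s = l / 2 ^ i"
        have s: "0 < s" using l by (simp add: s_def)
        obtain d where d: "Q k = hcube d s"
          using dyadic_levelE[OF l i] unfolding s_def by metis
        \<comment> \<open>Porosity compares volumes; \<open>\<delta> ^ n \<le> \<delta>\<close> turns this into a comparison of sides.\<close>
        have "\<delta> * (l / 2 ^ j) \<le> s"
        proof (rule ccontr)
          assume "\<not> \<delta> * (l / 2 ^ j) \<le> s"
          then have "s ^ ?n < (\<delta> * (l / 2 ^ j)) ^ ?n" using s by (intro power_strict_mono) auto
          also have "\<dots> \<le> \<delta> * (l / 2 ^ j) ^ ?n"
            unfolding power_mult_distrib using \<delta> l power_decreasing[of 1 ?n \<delta>]
            by (intro mult_right_mono) (auto simp: Suc_leI)
          also have "\<dots> \<le> s ^ ?n"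
            using big[OF k] l s unfolding M(1) d by (simp add: measure_hcube)
          finally show False by simp
        qed
        then have "4 * real ?n * (\<delta> * (l / 2 ^ j)) \<le> 4 * real ?n * s"
          by (rule mult_left_mono) simp
        moreover have "\<delta> * S \<le> \<delta> * (4 * real ?n * (l / 2 ^ j))"
          using M_side \<delta> by (intro mult_left_mono) auto
        ultimately have "\<delta> * S \<le> 4 * real ?n * s" by (simp add: mult.left_commute)
        then have \<kappa>S: "\<kappa> * S \<le> s / 4" using n by (simp add: \<kappa>_def field_simps)
        let ?H = "hcube (d + (s / 4) *\<^sub>R 1) (s / 2)"
        have "?H \<subseteq> Q k"
        proof
          fix x assume x: "x \<in> ?H"
          have "d $ i \<le> x $ i \<and> x $ i < d $ i + s" for i
          proof -
            have "d $ i + s / 4 \<le> x $ i" "x $ i < d $ i + s / 4 + s / 2"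
              using x by (auto simp: hcube_def)
            then show ?thesis using s by linarith
          qed
          then show "x \<in> Q k" by (simp add: d hcube_def)
        qed
        moreover have "Q k \<subseteq> ?P" using dyadic_level_subset[OF l i] .
        moreover have "\<kappa> * S \<le> infdist x E" if "x \<in> ?H" for x
          using infdist_free_hcube[OF assms(1) free[unfolded d] that] \<kappa>S by linarith
        ultimately have "?H \<subseteq> G \<inter> Q k" by (auto simp: G_def)
        then have "measure lebesgue ?H \<le> measure lebesgue (G \<inter> Q k)"
          using G_meas by (intro measure_mono_fmeasurable) (auto simp: d fmeasurable.Int)
        then show ?thesis using s by (simp add: d measure_hcube power_divide)
      qed
      have GQ: "G \<inter> Q k \<in> lmeasurable" if "k \<in> {1..N}" for k
        using piece[OF that] G_meas by (auto intro: fmeasurable.Int)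
      have "c / 2 ^ ?n * l ^ ?n \<le> (\<Sum>k = 1..N. measure lebesgue (Q k)) / 2 ^ ?n"
        using total l by (simp add: measure_hcube divide_right_mono)
      also have "\<dots> \<le> (\<Sum>k = 1..N. measure lebesgue (G \<inter> Q k))"
        unfolding sum_divide_distrib using piece by (intro sum_mono) blast
      also have "\<dots> = measure lebesgue (\<Union>k\<in>{1..N}. G \<inter> Q k)"
        using disj GQ[THEN fmeasurableD] GQ[THEN emeasure_eq_measure2]
        by (intro measure_finite_Union[symmetric]) (auto simp: disjoint_family_on_def)
      also have "\<dots> \<le> measure lebesgue G"
        using GQ[THEN fmeasurableD] G_meas
        by (intro measure_mono_fmeasurable sets.finite_UN) auto
      finally show ?thesis .
    qed
    then show ?thesis using S by (simp add: S_def G_def)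
  qed
  then have "mostly_distant (c / 2 ^ ?n) \<kappa> E" by (auto simp: mostly_distant_def)
  moreover have "c / 2 ^ ?n < 1"
    using c by (simp add: divide_less_eq order_less_le_trans[OF _ one_le_power])
  ultimately show ?thesis using that[of "c / 2 ^ ?n" \<kappa>] c \<kappa> by simp
qed

text \<open>The free cubes are all those of one dyadic level: the first one where \<open>n\<close> times the side, a bound
  for the diameter, is less than \<open>\<kappa> S\<close>. Every cube of this level that contains a point at distance
  at least \<open>\<kappa> S\<close> is free, so the free ones cover a proportion \<open>c\<close>. Minimality of the level bounds their side below by a multiple of \<open>S\<close>, which in turn
  dominates the side of any free subcube.\<close>

lemma mostly_distant_imp_weakly_porous:
  fixes E :: "(real ^ 'n) set"
  assumes "E \<noteq> {}" "0 < c" "c < 1" "0 < \<kappa>" "\<kappa> < 1" "mostly_distant c \<kappa> E"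
  shows "weakly_porous E"
proof -
  let ?n = "CARD('n)"
  have n: "0 < ?n" "1 \<le> real ?n" by (auto simp: Suc_leI)
  \<comment> \<open>A bound for the ratio of sides; the ratio of volumes is bounded by its power. The factor 8 is 4
    from the distance in a free cube times 2 from the step to the next level.\<close>
  define \<delta> where "\<delta> = \<kappa> / (8 * real ?n)"
  have \<delta>: "0 < \<delta>" "\<delta> < 1"
  proof -
    show "0 < \<delta>" using assms n by (simp add: \<delta>_def)
    have "\<kappa> < 1 * (8 * real ?n)" using assms(5) n(2) by linarith
    then show "\<delta> < 1" using n by (simp add: \<delta>_def pos_divide_less_eq)
  qed
  have "\<exists>(N :: nat) Q. 1 \<le> N \<and>
              (\<forall>k \<in> {1..N}. Q k \<in> free_subcubes E P) \<and>
              disjoint_family_on Q {1..N} \<and>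
              (\<forall>k \<in> {1..N}. measure lebesgue (Q k) \<ge> \<delta> ^ ?n * measure lebesgue (max_free_subcube E P)) \<and>
              (\<Sum>k = 1..N. measure lebesgue (Q k)) \<ge> c * measure lebesgue P"
    if "is_cube P" for P
  proof -
    obtain a l where l: "0 < l" and P: "P = hcube a l" using \<open>is_cube P\<close> by (auto simp: is_cube_def)
    define S where "S = max_dist E P"
    define G where "G = {x \<in> P. \<kappa> * S \<le> infdist x E}"
    have S: "0 < S" and G: "c * l ^ ?n \<le> measure lebesgue G"
      using assms(6) l by (auto simp: mostly_distant_def S_def G_def P)
    define j where "j = (LEAST j. real ?n * (l / 2 ^ j) < \<kappa> * S)"
    have "\<exists>j. real ?n * (l / 2 ^ j) < \<kappa> * S"
    proof -
      obtain j where "real ?n * l / (\<kappa> * S) < 2 ^ j" using real_arch_pow[of 2] by auto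
      then show ?thesis using assms S by (auto simp: field_simps)
    qed
    then have j: "real ?n * (l / 2 ^ j) < \<kappa> * S" unfolding j_def by (rule LeastI_ex)
    have j_min: "\<kappa> * S \<le> real ?n * (l / 2 ^ i)" if "i < j" for i
      using not_less_Least that unfolding j_def by (metis not_less)
    define F where "F = {Q \<in> dyadic_level j P. E \<inter> Q = {}}"
    have fin: "finite F" unfolding F_def P by (rule finite_subset[OF _ finite_dyadic_level[OF l]]) auto
    have F_meas: "Q \<in> lmeasurable" if "Q \<in> F" for Q
      using that dyadic_level_lmeasurable[OF l] by (auto simp: F_def P)
    have F_disj: "disjoint F" using dyadic_level_disjoint[of j P] by (auto simp: F_def disjoint_def)
    have "G \<subseteq> \<Union> F"
    proof
      fix x assume x: "x \<in> G"
      then obtain b where b: "hcube b (l / 2 ^ j) \<in> dyadic_level j P" "x \<in> hcube b (l / 2 ^ j)"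
        using dyadic_subcube_at[OF l, of x a] unfolding G_def P by blast
      have "E \<inter> hcube b (l / 2 ^ j) = {}"
        using x j by (intro free_if_distant[OF b(2)]) (auto simp: G_def)
      then show "x \<in> \<Union> F" using b by (auto simp: F_def)
    qed
    then have "measure lebesgue G \<le> measure lebesgue (\<Union> F)"
      using fin F_meas unfolding G_def P
      by (intro measure_mono_fmeasurable fmeasurableD[OF lmeasurable_hcube_Collect])
        (auto simp: fmeasurable.finite_Union subsetI)
    also have "\<dots> = (\<Sum>Q\<in>F. measure lebesgue Q)"
      using measure_finite_Union[of F "\<lambda>Q. Q" lebesgue] fin F_meas F_disj
      by (auto simp: disjoint_family_on_def disjoint_def emeasure_eq_measure2)
    finally have total: "c * l ^ ?n \<le> (\<Sum>Q\<in>F. measure lebesgue Q)" using G by linarith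
    have "F \<noteq> {}"
    proof
      assume "F = {}"
      then show False using total mult_pos_pos[OF assms(2) zero_less_power[OF l, of ?n]] by simp
    qed
    then have card: "1 \<le> card F" using fin by (simp add: Suc_leI card_gt_0_iff)
    obtain Q where Q: "bij_betw Q {1..card F} F" using ex_bij_betw_nat_finite_1[OF fin] by blast
    then have QF: "Q k \<in> F" if "k \<in> {1..card F}" for k using that by (auto simp: bij_betw_def)
    have "free_subcubes E P \<noteq> {}"
      using \<open>F \<noteq> {}\<close> by (auto simp: F_def free_subcubes_def dyadic_subcubes_def)
    then obtain b i where M: "max_free_subcube E P = hcube b (l / 2 ^ i)"
      "hcube b (l / 2 ^ i) \<subseteq> P" "E \<inter> hcube b (l / 2 ^ i) = {}"
      using max_free_subcube_hcube[OF l, of E a] unfolding P by metis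
    have side: "\<delta> * (l / 2 ^ i) \<le> l / 2 ^ j"
    proof (cases j)
      case 0
      have "\<delta> * (l / 2 ^ i) \<le> 1 * l"
        using \<delta> l by (intro mult_mono) (auto simp: divide_le_eq order_trans[OF _ one_le_power])
      then show ?thesis using 0 by simp
    next
      case (Suc j')
      have "\<kappa> * (l / 2 ^ i / 4) \<le> \<kappa> * S"
        using assms l M unfolding S_def P
        by (intro mult_left_mono max_dist_free_hcube) auto
      also have "\<dots> \<le> real ?n * (l / 2 ^ j')" using j_min[of j'] Suc by simp
      finally show ?thesis using n Suc by (simp add: \<delta>_def field_simps)
    qed
    have "\<delta> ^ ?n * measure lebesgue (max_free_subcube E P) \<le> measure lebesgue (Q k)"
      if k: "k \<in> {1..card F}" for k
    proof -
      obtain d where d: "Q k = hcube d (l / 2 ^ j)"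
        using QF[OF k] l by (auto simp: F_def P elim: dyadic_levelE)
      have "(\<delta> * (l / 2 ^ i)) ^ ?n \<le> (l / 2 ^ j) ^ ?n"
        using side \<delta> l by (intro power_mono) auto
      then have "\<delta> ^ ?n * (l / 2 ^ i) ^ ?n \<le> (l / 2 ^ j) ^ ?n"
        unfolding power_mult_distrib .
      then show ?thesis using l by (simp add: d M measure_hcube)
    qed
    moreover have "disjoint_family_on Q {1..card F}"
      unfolding disjoint_family_on_def
    proof (intro ballI impI)
      fix k k' assume kk: "k \<in> {1..card F}" "k' \<in> {1..card F}" "k \<noteq> k'"
      then have "Q k \<noteq> Q k'"
        using inj_onD[OF bij_betw_imp_inj_on[OF Q], of k k'] by blast
      then show "Q k \<inter> Q k' = {}" 
        using F_disj QF[OF kk(1)] QF[OF kk(2)] unfolding disjoint_def by blast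
    qed
    moreover have "c * measure lebesgue P \<le> (\<Sum>k = 1..card F. measure lebesgue (Q k))"
      using total l unfolding sum.reindex_bij_betw[OF Q] by (simp add: P measure_hcube)
    moreover have "\<forall>k\<in>{1..card F}. Q k \<in> free_subcubes E P"
      using QF unfolding F_def free_subcubes_def dyadic_subcubes_def by blast
    ultimately show ?thesis using card by blast
  qed
  moreover have "0 < \<delta> ^ ?n" "\<delta> ^ ?n < 1" using \<delta> by (auto simp: power_less_one_iff)
  ultimately show ?thesis using assms unfolding weakly_porous_def by blast
qed

section \<open>From the Muckenhoupt condition to the level sets of the distance\<close>

lemma borel_measurable_dist_neg_power:
  "dist_neg_power E \<alpha> \<in> borel_measurable borel"
  unfolding dist_neg_power_def by measurable

lemma measurable_dist_neg_power:
  "dist_neg_power E \<alpha> \<in> borel_measurable lebesgue"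
  using borel_measurable_dist_neg_power[of E \<alpha>] by (intro measurable_completion) simp

lemma dist_neg_power_ge:
  assumes "0 \<le> \<alpha>" "0 < r" "infdist x E \<le> r"
  shows "ennreal (r powr (- \<alpha>)) \<le> dist_neg_power E \<alpha> x"
  using assms infdist_nonneg[of x E]
  by (auto simp: dist_neg_power_def intro!: ennreal_leI powr_mono2')

lemma dist_neg_power_le:
  assumes "0 \<le> \<alpha>" "0 < r" "r \<le> infdist x E"
  shows "dist_neg_power E \<alpha> x \<le> ennreal (r powr (- \<alpha>))"
  using assms by (auto simp: dist_neg_power_def intro!: ennreal_leI powr_mono2')

text \<open>If the largest distance vanishes, the function is infinite on the whole cube.\<close>

lemma max_dist_pos_if_locally_integrable:
  assumes "locally_integrable (dist_neg_power E \<alpha>)" "0 < l"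
  shows "0 < max_dist E (hcube a l)"
proof (rule ccontr)
  assume S: "\<not> 0 < max_dist E (hcube a l)"
  let ?K = "cbox a (\<chi> i. a $ i + l)"
  have "infdist x E = 0" if "x \<in> hcube a l" for x
    using infdist_le_max_dist[OF that, of E] infdist_nonneg[of x E] S by linarith
  then have "\<infinity> * indicator (hcube a l) x \<le> dist_neg_power E \<alpha> x * indicator ?K x" for x
    using hcube_subset_cbox[of a l] by (auto simp: dist_neg_power_def indicator_def)
  then have "(\<integral>\<^sup>+x. \<infinity> * indicator (hcube a l) x \<partial>lebesgue)
      \<le> (\<integral>\<^sup>+x\<in>?K. dist_neg_power E \<alpha> x \<partial>lebesgue)"
    by (intro nn_integral_mono) auto
  also have "\<dots> < \<infinity>" using assms(1) compact_cbox unfolding locally_integrable_def by blast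
  finally show False
    using assms(2) emeasure_hcube[OF assms(2), of a]
    by (subst (asm) nn_integral_cmult_indicator) (auto simp: fmeasurableD ennreal_top_mult)
qed

text \<open>The essential infimum ignores the value at a single point. By continuity the distance
  exceeds half of its supremum on a whole subcube, and a cube has positive measure.\<close>

lemma ess_inf_dist_neg_power_le:
  fixes E :: "(real ^ 'n) set"
  assumes "0 \<le> \<alpha>" "0 < l" "0 < max_dist E (hcube a l)"
  shows "ess_inf_on (hcube a l) (dist_neg_power E \<alpha>)
    \<le> ennreal ((max_dist E (hcube a l) / 2) powr (- \<alpha>))"
  unfolding ess_inf_on_def
proof (rule Sup_least, clarify)
  let ?P = "hcube a l" and ?n = "real CARD('n)"
  define S where "S = max_dist E ?P"
  fix z assume z: "AE x in lebesgue. x \<in> ?P \<longrightarrow> z \<le> dist_neg_power E \<alpha> x"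
  have S: "0 < S" using assms by (simp add: S_def)
  \<comment> \<open>The gap between \<open>3 / 4\<close> and \<open>1 / 2\<close> leaves room for the diameter of the subcube.\<close>
  obtain x where x: "x \<in> ?P" "3 / 4 * S < infdist x E"
    using less_max_distE[OF assms(2), of "3 / 4 * S" E a] S by (auto simp: S_def)
  obtain j where "?n * l / (S / 4) < 2 ^ j" using real_arch_pow[of 2] by auto
  then have j: "?n * (l / 2 ^ j) < S / 4" using S by (simp add: field_simps)
  obtain b where b: "x \<in> hcube b (l / 2 ^ j)" "hcube b (l / 2 ^ j) \<subseteq> ?P"
    using dyadic_subcube_at[OF assms(2) x(1)] by metis
  have "\<exists>y\<in>hcube b (l / 2 ^ j). z \<le> dist_neg_power E \<alpha> y"
  proof (rule ccontr)
    assume "\<not> ?thesis"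
    then have "AE y in lebesgue. y \<notin> hcube b (l / 2 ^ j)"
      using z b(2) by (auto elim!: eventually_mono)
    then have "emeasure lebesgue (hcube b (l / 2 ^ j)) = 0"
      by (subst (asm) AE_iff_measurable[OF _ refl]) (auto simp: fmeasurableD)
    then show False using emeasure_hcube[of "l / 2 ^ j" b] assms(2) by simp
  qed
  then obtain y where y: "y \<in> hcube b (l / 2 ^ j)" "z \<le> dist_neg_power E \<alpha> y" by blast
  have "S / 2 \<le> infdist y E" using infdist_hcube_le[OF b(1) y(1), of E] x(2) j by linarith
  then have "dist_neg_power E \<alpha> y \<le> ennreal ((S / 2) powr (- \<alpha>))"
    using S assms by (intro dist_neg_power_le) auto
  then show "z \<le> ennreal ((max_dist E ?P / 2) powr (- \<alpha>))" using y(2) by (simp add: S_def)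
qed

text \<open>Chebyshev's inequality: where the distance is below \<open>\<kappa> S\<close> the function is at least \<open>(\<kappa> S)\<^sup>-\<^sup>\<alpha>\<close>, but
  its mean over the cube is at most \<open>C (S / 2)\<^sup>-\<^sup>\<alpha>\<close>. Hence this set has proportion at most
  \<open>C (2 \<kappa>)\<^sup>\<alpha>\<close>, and \<open>\<kappa>\<close> is chosen to make this at most \<open>1 / 2\<close>.\<close>

lemma muckenhoupt_imp_mostly_distant:
  fixes E :: "(real ^ 'n) set"
  assumes "0 < \<alpha>" "muckenhoupt_A1 (dist_neg_power E \<alpha>)"
  obtains \<kappa> where "0 < \<kappa>" "\<kappa> < 1" "mostly_distant (1 / 2) \<kappa> E"
proof -
  let ?w = "dist_neg_power E \<alpha>" and ?n = "CARD('n)"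
  obtain C where C: "0 \<le> C" and A1: "\<And>Q. is_cube Q \<Longrightarrow>
      (\<integral>\<^sup>+x\<in>Q. ?w x \<partial>lebesgue) / emeasure lebesgue Q \<le> ennreal C * ess_inf_on Q ?w"
    and loc: "locally_integrable ?w"
    using assms(2) unfolding muckenhoupt_A1_def weight_def by blast
  \<comment> \<open>\<open>C + 1\<close> instead of \<open>C\<close> because \<open>C = 0\<close> is not excluded at this point.\<close>
  define q where "q = 1 / (2 * (C + 1))"
  have q: "0 < q" "q < 1" "C * q \<le> 1 / 2" using C by (auto simp: q_def field_simps)
  define \<kappa> where "\<kappa> = q powr (1 / \<alpha>) / 2"
  have \<kappa>: "0 < \<kappa>" "\<kappa> < 1"
    using q assms(1) powr_less_mono2[of "1 / \<alpha>" q 1] by (auto simp: \<kappa>_def)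
  have \<kappa>_powr: "(2 * \<kappa>) powr \<alpha> = q" using q assms(1) by (simp add: \<kappa>_def powr_powr)
  have "0 < max_dist E (hcube a l) \<and> 1 / 2 * l ^ ?n
      \<le> measure lebesgue {x \<in> hcube a l. \<kappa> * max_dist E (hcube a l) \<le> infdist x E}"
    if l: "0 < l" for a l
  proof -
    let ?P = "hcube a l"
    define S where "S = max_dist E ?P"
    have S: "0 < S" unfolding S_def by (rule max_dist_pos_if_locally_integrable[OF loc l])
    define B where "B = {x \<in> ?P. infdist x E < \<kappa> * S}"
    have B: "B \<in> lmeasurable" unfolding B_def by (rule lmeasurable_hcube_Collect) measurable
    have "(\<integral>\<^sup>+x\<in>?P. ?w x \<partial>lebesgue) / emeasure lebesgue ?P \<le> ennreal C * ess_inf_on ?P ?w"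
      by (rule A1[OF is_cube_hcube[OF l]])
    also have "\<dots> \<le> ennreal C * ennreal ((S / 2) powr (- \<alpha>))"
      unfolding S_def using S l assms(1)
      by (intro mult_left_mono ess_inf_dist_neg_power_le) (auto simp: S_def)
    finally have mean: "(\<integral>\<^sup>+x\<in>?P. ?w x \<partial>lebesgue) / emeasure lebesgue ?P
      \<le> ennreal C * ennreal ((S / 2) powr (- \<alpha>))" .
    have "ennreal ((\<kappa> * S) powr (- \<alpha>)) * emeasure lebesgue B
        = (\<integral>\<^sup>+x. ennreal ((\<kappa> * S) powr (- \<alpha>)) * indicator B x \<partial>lebesgue)"
      using B by (simp add: nn_integral_cmult_indicator fmeasurableD)
    also have "\<dots> \<le> (\<integral>\<^sup>+x\<in>?P. ?w x \<partial>lebesgue)"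
      using assms(1) \<kappa> S
      by (intro nn_integral_mono) (auto simp: B_def indicator_def intro!: dist_neg_power_ge)
    also have "\<dots> = (\<integral>\<^sup>+x\<in>?P. ?w x \<partial>lebesgue) / emeasure lebesgue ?P * emeasure lebesgue ?P"
      unfolding ennreal_divide_times emeasure_hcube[OF l] using l by (simp add: ennreal_divide_self)
    also have "\<dots> \<le> ennreal C * ennreal ((S / 2) powr (- \<alpha>)) * emeasure lebesgue ?P"
      by (rule mult_right_mono[OF mean]) simp
    finally have "ennreal ((\<kappa> * S) powr (- \<alpha>) * measure lebesgue B)
        \<le> ennreal (C * (S / 2) powr (- \<alpha>) * l ^ ?n)"
      unfolding emeasure_hcube[OF l] emeasure_eq_measure2[OF B] using C l by (simp add: ennreal_mult)
    then have "(\<kappa> * S) powr (- \<alpha>) * measure lebesgue B \<le> C * (S / 2) powr (- \<alpha>) * l ^ ?n"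
      using C l by (subst (asm) ennreal_le_iff) auto
    then have "(\<kappa> * S) powr \<alpha> * ((\<kappa> * S) powr (- \<alpha>) * measure lebesgue B)
        \<le> (\<kappa> * S) powr \<alpha> * (C * (S / 2) powr (- \<alpha>) * l ^ ?n)"
      by (rule mult_left_mono) simp
    moreover have "(\<kappa> * S) powr \<alpha> * (\<kappa> * S) powr (- \<alpha>) = 1"
      using \<kappa> S by (simp add: powr_minus)
    moreover have "(\<kappa> * S) powr \<alpha> * (S / 2) powr (- \<alpha>) = q"
    proof -
      have "(\<kappa> * S) powr \<alpha> = q * (S / 2) powr \<alpha>"
        using \<kappa> S \<kappa>_powr powr_mult[of "2 * \<kappa>" "S / 2" \<alpha>] by simp
      then show ?thesis using S by (simp add: powr_minus)
    qed
    moreover have "(\<kappa> * S) powr \<alpha> * (C * (S / 2) powr (- \<alpha>) * l ^ ?n)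
        = C * ((\<kappa> * S) powr \<alpha> * (S / 2) powr (- \<alpha>)) * l ^ ?n"
      by (simp only: ac_simps)
    ultimately have "measure lebesgue B \<le> C * q * l ^ ?n"
      by (metis mult.assoc mult_1)
    also have "\<dots> \<le> 1 / 2 * l ^ ?n" using q l by (intro mult_right_mono) auto
    finally show ?thesis
      using measure_hcube_Collect_compl[OF l, of a E "\<kappa> * S"] S by (simp add: B_def S_def)
  qed
  then have "mostly_distant (1 / 2) \<kappa> E" by (auto simp: mostly_distant_def)
  then show ?thesis using that \<kappa> by blast
qed

section \<open>Doubling of the largest distance\<close>

text \<open>A subcube that misses less than the proportion \<open>c\<close> of a cube contains one of the points at distance
  at least \<open>\<kappa>\<close> times the largest distance.\<close>

lemma mostly_distant_max_dist_le:
  fixes a :: "real ^ 'n"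
  assumes "mostly_distant c \<kappa> E" "0 < l" "hcube a l \<subseteq> hcube b m" "0 < m"
    "(1 - c) * m ^ CARD('n) < l ^ CARD('n)"
  shows "\<kappa> * max_dist E (hcube b m) \<le> max_dist E (hcube a l)"
proof (rule ccontr)
  assume less: "\<not> ?thesis"
  let ?G = "{x \<in> hcube b m. \<kappa> * max_dist E (hcube b m) \<le> infdist x E}"
  have "?G \<subseteq> hcube b m - hcube a l"
    using less infdist_le_max_dist[of _ a l E] by force
  moreover have "?G \<in> sets lebesgue"
    by (rule fmeasurableD, rule lmeasurable_hcube_Collect) measurable
  ultimately have "measure lebesgue ?G \<le> measure lebesgue (hcube b m - hcube a l)"
    by (intro measure_mono_fmeasurable) (auto simp: fmeasurable.Diff)
  also have "\<dots> = m ^ CARD('n) - l ^ CARD('n)"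
    using assms by (simp add: measurable_measure_Diff fmeasurableD measure_hcube)
  also have "\<dots> < c * m ^ CARD('n)" using assms(5) by (simp add: algebra_simps)
  finally show False using assms(1,4) unfolding mostly_distant_def by (meson not_less)
qed

text \<open>The preceding bound applies only to cubes of nearly equal size. A cube and a cube of twice its side
  that contains it are joined by a chain of cubes, interpolating corner and side linearly in \<open>K\<close>
  steps; the loss is \<open>\<kappa>\<close> per step, thus a constant \<open>\<eta> = \<kappa> ^ K\<close> in total.\<close>

lemma mostly_distant_doubling:
  fixes E :: "(real ^ 'n) set"
  assumes "mostly_distant c \<kappa> E" "0 < c" "0 < \<kappa>" "\<kappa> < 1"
  obtains \<eta> where "0 < \<eta>" "\<eta> < 1" "\<And>a b l. 0 < l \<Longrightarrow> hcube a l \<subseteq> hcube b (2 * l) \<Longrightarrow>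
    \<eta> * max_dist E (hcube b (2 * l)) \<le> max_dist E (hcube a l)"
proof -
  let ?n = "CARD('n)"
  obtain K :: nat where K: "real ?n / c < real K" using reals_Archimedean2 by blast
  then have K_pos: "0 < K" using assms(2) by (intro gr0I) (simp add: divide_less_0_iff)
  have "\<kappa> ^ K * max_dist E (hcube b (2 * l)) \<le> max_dist E (hcube a l)"
    if l: "0 < l" and sub: "hcube a l \<subseteq> hcube b (2 * l)" for a b l
  proof -
    have ba: "b $ i \<le> a $ i" "a $ i \<le> b $ i + l" for i
      using hcube_subset_imp[OF l sub, of i] by auto
    define \<tau> where "\<tau> i = real i / real K" for i
    define R where "R i = hcube (a + \<tau> i *\<^sub>R (b - a)) (l * (1 + \<tau> i))" for i
    have \<tau>: "0 \<le> \<tau> i" "\<tau> i \<le> \<tau> (Suc i)" for i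
      using K_pos by (auto simp: \<tau>_def divide_right_mono)
    have R0: "R 0 = hcube a l" by (simp add: R_def \<tau>_def)
    have RK: "R K = hcube b (2 * l)" using K_pos by (simp add: R_def \<tau>_def mult.commute)
    have "\<kappa> ^ i * max_dist E (R i) \<le> max_dist E (R 0)" for i
    proof (induction i)
      case (Suc i)
      have sub: "R i \<subseteq> R (Suc i)"
      proof
        fix x assume x: "x \<in> R i"
        have "(a + \<tau> (Suc i) *\<^sub>R (b - a)) $ k \<le> x $ k \<and>
          x $ k < (a + \<tau> (Suc i) *\<^sub>R (b - a)) $ k + l * (1 + \<tau> (Suc i))" for k
        proof -
          have "a $ k + \<tau> i * (b $ k - a $ k) \<le> x $ k"
            "x $ k < a $ k + \<tau> i * (b $ k - a $ k) + l * (1 + \<tau> i)"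
            using x by (auto simp: R_def hcube_def)
          \<comment> \<open>Lower faces move down since \<open>b \<le> a\<close>, upper faces move up since \<open>a + l \<le> b + 2 l\<close>.\<close>
          moreover have "\<tau> (Suc i) * (b $ k - a $ k) \<le> \<tau> i * (b $ k - a $ k)"
            using \<tau> ba by (intro mult_right_mono_neg) auto
          moreover have "\<tau> i * (b $ k - a $ k + l) \<le> \<tau> (Suc i) * (b $ k - a $ k + l)"
            using \<tau> ba[of k] by (intro mult_right_mono) auto
          ultimately show ?thesis by (simp add: algebra_simps)
        qed
        then show "x \<in> R (Suc i)" by (simp add: R_def hcube_def)
      qed
      define h where "h = 1 / (real K + real i + 1)"
      have h: "0 < h" "h \<le> 1" "real ?n * h < c"
      proof -
        show "0 < h" "h \<le> 1" using K_pos by (auto simp: h_def)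
        have "real ?n < c * real K" using K assms(2) by (simp add: field_simps)
        also have "\<dots> \<le> c * (real K + real i + 1)"
          using assms(2) by (intro mult_left_mono) auto
        finally have "real ?n < c * (real K + real i + 1)" .
        then show "real ?n * h < c" using K_pos by (simp add: h_def pos_divide_less_eq)
      qed
      have ratio: "l * (1 + \<tau> i) = (1 - h) * (l * (1 + \<tau> (Suc i)))"
      proof -
        have "1 + \<tau> i = (real K + real i) / real K"
          "1 + \<tau> (Suc i) = (real K + real i + 1) / real K"
          using K_pos by (auto simp: \<tau>_def field_simps)
        moreover have "1 - h = (real K + real i) / (real K + real i + 1)"
          by (simp add: h_def field_simps)
        ultimately show ?thesis by simp
      qed
      have pos: "0 < l * (1 + \<tau> i)" for i using l \<tau>(1)[of i] by simp
      \<comment> \<open>The choice \<open>K > n / c\<close> together with Bernoulli's inequality makes one step lose less than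
        the proportion \<open>c\<close> of the measure.\<close>
      have "1 - c < (1 - h) ^ ?n" using Bernoulli_inequality[of "- h" ?n] h by simp
      then have "(1 - c) * (l * (1 + \<tau> (Suc i))) ^ ?n < (l * (1 + \<tau> i)) ^ ?n"
        unfolding ratio power_mult_distrib[of "1 - h"] using pos[of "Suc i"]
        by (intro mult_strict_right_mono) auto
      then have "\<kappa> * max_dist E (R (Suc i)) \<le> max_dist E (R i)"
        using sub pos unfolding R_def by (intro mostly_distant_max_dist_le[OF assms(1)])
      then have "\<kappa> ^ i * (\<kappa> * max_dist E (R (Suc i))) \<le> \<kappa> ^ i * max_dist E (R i)"
        using assms by (intro mult_left_mono) auto
      then show ?case using Suc.IH by (simp add: mult.assoc mult.left_commute)
    qed simp
    from this[of K] show ?thesis unfolding R0 RK .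
  qed
  moreover have "0 < \<kappa> ^ K" "\<kappa> ^ K < 1" using assms K_pos by (auto simp: power_less_one_iff)
  ultimately show ?thesis using that by blast
qed

section \<open>Decay of the level sets\<close>

lemma measure_hcube_Collect_split:
  fixes a :: "real ^ 'n"
  assumes "0 < l" and p: "Measurable.pred borel p"
  shows "measure lebesgue {x \<in> hcube a l. p x}
    = (\<Sum>R\<in>dyadic_level 1 (hcube a l). measure lebesgue {x \<in> R. p x})"
proof -
  let ?D = "dyadic_level 1 (hcube a l)"
  have meas: "{x \<in> R. p x} \<in> lmeasurable" if "R \<in> ?D" for R
    using dyadic_levelE[OF assms(1) that] lmeasurable_hcube_Collect[OF p] by metis
  have "{x \<in> hcube a l. p x} = (\<Union>R\<in>?D. {x \<in> R. p x})"
    using dyadic_level_Union[OF is_cube_hcube[OF assms(1)], of 1 a] by blast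
  moreover have "disjoint_family_on (\<lambda>R. {x \<in> R. p x}) ?D"
    using dyadic_level_disjoint[of 1 "hcube a l"] unfolding disjoint_def disjoint_family_on_def
    by blast
  ultimately show ?thesis
    using finite_dyadic_level[OF assms(1)] meas[THEN fmeasurableD] meas[THEN emeasure_eq_measure2]
    by (auto intro!: measure_finite_Union)
qed

text \<open>If a rough estimate \<open>q\<close> for the set \<open>{dist \<le> s}\<close> is known on all cubes whose largest distance is at least
  \<open>\<eta> t\<close>, then relative to \<open>{dist < t}\<close> it holds on every cube with largest distance at least \<open>t\<close>. This is a
  stopping-time argument: subdivide dyadically and stop at the first cubes with largest distance
  below \<open>t\<close>. They lie in \<open>{dist < t}\<close>, and doubling, applied to the parent, makes the estimate available on them.
  Since \<open>s < t\<close>, a cube of diameter less than \<open>t - s\<close> that has not been stopped contains no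
  point with distance at most \<open>s\<close>. So finitely many subdivisions suffice, and the argument becomes an
  induction on their number \<open>J\<close> in which each step splits a cube into its children.\<close>

lemma measure_sublevel_le:
  fixes E :: "(real ^ 'n) set"
  assumes doubling: "\<And>a b l. 0 < l \<Longrightarrow> hcube a l \<subseteq> hcube b (2 * l) \<Longrightarrow>
      \<eta> * max_dist E (hcube b (2 * l)) \<le> max_dist E (hcube a l)"
    and small: "\<And>a l. 0 < l \<Longrightarrow> \<eta> * t \<le> max_dist E (hcube a l) \<Longrightarrow>
      measure lebesgue {x \<in> hcube a l. infdist x E \<le> s} \<le> q * l ^ CARD('n)"
    and st: "s < t" and "0 \<le> \<eta>" "0 \<le> q"
    and "0 < l" "t \<le> max_dist E (hcube a l)"
  shows "measure lebesgue {x \<in> hcube a l. infdist x E \<le> s}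
    \<le> q * measure lebesgue {x \<in> hcube a l. infdist x E < t}"
proof -
  have *: "measure lebesgue {x \<in> hcube a l. infdist x E \<le> s}
      \<le> q * measure lebesgue {x \<in> hcube a l. infdist x E < t}"
    if "real CARD('n) * l < 2 ^ J * (t - s)" "0 < l" "t \<le> max_dist E (hcube a l)" for J a l
    using that
  proof (induction J arbitrary: a l)
    case 0
    have "s < infdist x E" if "x \<in> hcube a l" for x
      using max_dist_le_add[OF 0(2) that, of E] 0 by simp
    then have "{x \<in> hcube a l. infdist x E \<le> s} = {}" by fastforce
    then show ?case using \<open>0 \<le> q\<close> by (simp only: measure_empty) simp
  next
    case (Suc J)
    let ?D = "dyadic_level 1 (hcube a l)"
    have l2: "0 < l / 2" using Suc.prems by simp
    have "measure lebesgue {x \<in> R. infdist x E \<le> s} \<le> q * measure lebesgue {x \<in> R. infdist x E < t}"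
      if R: "R \<in> ?D" for R
    proof -
      obtain b where b: "R = hcube b (l / 2)" using dyadic_levelE[OF Suc.prems(2) R] by auto
      have sub: "hcube b (l / 2) \<subseteq> hcube a (2 * (l / 2))"
        using dyadic_level_subset[OF Suc.prems(2) R] b by simp
      show ?thesis
      proof (cases "t \<le> max_dist E R")
        case True
        then show ?thesis unfolding b using Suc.prems by (intro Suc.IH) auto
      next
        case False
        have "\<eta> * t \<le> \<eta> * max_dist E (hcube a l)"
          using Suc.prems \<open>0 \<le> \<eta>\<close> by (intro mult_left_mono)
        also have "\<dots> \<le> max_dist E R" using doubling[OF l2 sub] b by simp
        finally have "measure lebesgue {x \<in> R. infdist x E \<le> s} \<le> q * measure lebesgue R"
          unfolding b measure_hcube[OF l2] by (rule small[OF l2])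
        moreover have "{x \<in> R. infdist x E < t} = R"
          using False infdist_le_max_dist[of _ b "l / 2" E] unfolding b by fastforce
        ultimately show ?thesis by simp
      qed
    qed
    then have "(\<Sum>R\<in>?D. measure lebesgue {x \<in> R. infdist x E \<le> s})
        \<le> q * (\<Sum>R\<in>?D. measure lebesgue {x \<in> R. infdist x E < t})"
      unfolding sum_distrib_left by (rule sum_mono)
    moreover have p: "Measurable.pred borel (\<lambda>x::real ^ 'n. infdist x E \<le> s)"
      "Measurable.pred borel (\<lambda>x::real ^ 'n. infdist x E < t)" by measurable
    ultimately show ?case
      unfolding p[THEN measure_hcube_Collect_split[OF Suc.prems(2)]] by blast
  qed
  obtain J where "real CARD('n) * l / (t - s) < 2 ^ J" using real_arch_pow[of 2] by auto
  then have "real CARD('n) * l < 2 ^ J * (t - s)" using st by (simp add: pos_divide_less_eq)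
  then show ?thesis using assms by (intro *) auto
qed

text \<open>Each factor \<open>\<theta> = \<eta> \<kappa>\<close> in the threshold gains a factor \<open>1 - c\<close> in the measure. In the inductive step
  the sublevel set for \<open>\<theta> ^ Suc m\<close> is compared with \<open>{dist < \<kappa> S}\<close>, which has proportion at most \<open>1 - c\<close>; the rough
  estimate needed for this is the induction hypothesis for \<open>m\<close>, because cubes with largest distance
  at least \<open>\<eta> \<kappa> S\<close> have \<open>\<theta> ^ Suc m * S \<le> \<theta> ^ m\<close> times their own largest distance.\<close>

lemma mostly_distant_level_set_decay:
  fixes E :: "(real ^ 'n) set"
  assumes "mostly_distant c \<kappa> E" "0 < c" "c < 1" "0 < \<kappa>" "\<kappa> < 1"
  obtains \<theta> where "0 < \<theta>" "\<theta> < 1" "\<And>m a l. 0 < l \<Longrightarrow>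
    measure lebesgue {x \<in> hcube a l. infdist x E \<le> \<theta> ^ m * max_dist E (hcube a l)}
      \<le> (1 - c) ^ m * l ^ CARD('n)"
proof -
  let ?n = "CARD('n)"
  obtain \<eta> where \<eta>: "0 < \<eta>" "\<eta> < 1" and doubling: "\<And>a b l. 0 < l \<Longrightarrow> hcube a l \<subseteq> hcube b (2 * l) \<Longrightarrow>
    \<eta> * max_dist E (hcube b (2 * l)) \<le> max_dist E (hcube a l)"
    using mostly_distant_doubling[OF assms(1,2,4,5)] by blast
  define \<theta> where "\<theta> = \<eta> * \<kappa>"
  have \<theta>: "0 < \<theta>" "\<theta> < \<kappa>" "\<theta> < 1"
  proof -
    show "0 < \<theta>" using \<eta> assms by (simp add: \<theta>_def)
    show "\<theta> < \<kappa>" using \<eta> assms by (simp add: \<theta>_def)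
    then show "\<theta> < 1" using assms by linarith
  qed
  have "measure lebesgue {x \<in> hcube a l. infdist x E \<le> \<theta> ^ m * max_dist E (hcube a l)}
      \<le> (1 - c) ^ m * l ^ ?n" if "0 < l" for m a l
    using that
  proof (induction m arbitrary: a l)
    case 0
    have "{x \<in> hcube a l. infdist x E \<le> \<theta> ^ 0 * max_dist E (hcube a l)} = hcube a l"
      using infdist_le_max_dist[of _ a l E] by auto
    then show ?case using measure_hcube[OF 0, of a] by simp
  next
    case (Suc m)
    define S where "S = max_dist E (hcube a l)"
    have S: "0 < S" using assms(1) Suc.prems unfolding mostly_distant_def S_def by blast
    have \<theta>m: "\<theta> ^ Suc m * S < \<kappa> * S"
    proof -
      have "\<theta> ^ Suc m \<le> \<theta>" using \<theta> by (simp add: mult_left_le power_le_one)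
      then have "\<theta> ^ Suc m < \<kappa>" using \<theta>(2) by (rule order_le_less_trans)
      then show ?thesis using S by (rule mult_strict_right_mono)
    qed
    have "measure lebesgue {x \<in> hcube a l. infdist x E \<le> \<theta> ^ Suc m * S}
        \<le> (1 - c) ^ m * measure lebesgue {x \<in> hcube a l. infdist x E < \<kappa> * S}"
    proof (rule measure_sublevel_le[OF doubling _ \<theta>m])
      fix b k assume k: "0 < k" "\<eta> * (\<kappa> * S) \<le> max_dist E (hcube b k)"
      then have "\<theta> ^ m * (\<eta> * (\<kappa> * S)) \<le> \<theta> ^ m * max_dist E (hcube b k)"
        using \<theta> by (intro mult_left_mono) auto
      then have "\<theta> ^ Suc m * S \<le> \<theta> ^ m * max_dist E (hcube b k)"
        by (simp add: \<theta>_def mult.commute mult.left_commute)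
      then have "{x \<in> hcube b k. infdist x E \<le> \<theta> ^ Suc m * S}
          \<subseteq> {x \<in> hcube b k. infdist x E \<le> \<theta> ^ m * max_dist E (hcube b k)}" by auto
      then have "measure lebesgue {x \<in> hcube b k. infdist x E \<le> \<theta> ^ Suc m * S}
          \<le> measure lebesgue {x \<in> hcube b k. infdist x E \<le> \<theta> ^ m * max_dist E (hcube b k)}"
        by (intro measure_mono_fmeasurable fmeasurableD lmeasurable_hcube_Collect) measurable
      then show "measure lebesgue {x \<in> hcube b k. infdist x E \<le> \<theta> ^ Suc m * S}
          \<le> (1 - c) ^ m * k ^ ?n" using Suc.IH[OF k(1), of b] by linarith
    next
      show "\<kappa> * S \<le> max_dist E (hcube a l)" using S assms by (simp add: S_def[symmetric])
    qed (use \<eta> assms Suc.prems in auto)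
    also have "\<dots> \<le> (1 - c) ^ m * ((1 - c) * l ^ ?n)"
    proof (rule mult_left_mono)
      have "c * l ^ ?n \<le> measure lebesgue {x \<in> hcube a l. \<kappa> * S \<le> infdist x E}"
        using assms(1) Suc.prems unfolding mostly_distant_def S_def by blast
      then show "measure lebesgue {x \<in> hcube a l. infdist x E < \<kappa> * S} \<le> (1 - c) * l ^ ?n"
        using measure_hcube_Collect_compl[OF Suc.prems, of a E "\<kappa> * S"]
        by (simp add: algebra_simps)
    qed (use assms in simp)
    finally show ?case by (simp add: S_def mult.assoc mult.left_commute)
  qed
  then show ?thesis using that \<theta> by blast
qed

section \<open>From level sets to the Muckenhoupt condition\<close>

lemma power_bracket:
  fixes \<theta> :: real
  assumes "0 < \<theta>" "\<theta> < 1" "0 < u" "u \<le> S"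
  obtains m where "\<theta> ^ Suc m * S < u" "u \<le> \<theta> ^ m * S"
proof -
  have S: "0 < S" using assms by linarith
  obtain k where "\<theta> ^ k < u / S" using real_arch_pow_inv[of "u / S" \<theta>] assms S by auto
  then have ex: "\<exists>k. \<theta> ^ k * S < u" using S by (auto simp: field_simps)
  define k where "k = (LEAST k. \<theta> ^ k * S < u)"
  have k: "\<theta> ^ k * S < u" unfolding k_def using ex by (rule LeastI_ex)
  then have "k \<noteq> 0" using assms by (intro notI) simp
  then obtain m where m: "k = Suc m" by (cases k) auto
  have "\<not> \<theta> ^ m * S < u" using not_less_Least[of m "\<lambda>k. \<theta> ^ k * S < u"] m unfolding k_def by auto
  then show ?thesis using that k m by simp
qed

text \<open>Where the distance lies between \<open>\<theta> ^ Suc m * S\<close> and \<open>\<theta> ^ m * S\<close>, the integrand is at most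
  \<open>(\<theta>\<^sup>-\<^sup>\<alpha>) ^ Suc m * S\<^sup>-\<^sup>\<alpha>\<close>, while this set has proportion at most \<open>q ^ m\<close>. The sum over \<open>m\<close> is a
  geometric series with ratio \<open>\<theta>\<^sup>-\<^sup>\<alpha> q\<close>. The points at distance 0, where the integrand is infinite,
  lie in all the sublevel sets and form a null set.\<close>

lemma nn_integral_dist_neg_power_le:
  fixes E :: "(real ^ 'n) set"
  assumes \<theta>: "0 < \<theta>" "\<theta> < 1" and q: "0 \<le> q" "q < 1" and \<alpha>: "0 < \<alpha>"
    and conv: "\<theta> powr (- \<alpha>) * q < 1"
    and l: "0 < l" and S: "0 < max_dist E (hcube a l)"
    and decay: "\<And>m. measure lebesgue {x \<in> hcube a l. infdist x E \<le> \<theta> ^ m * max_dist E (hcube a l)}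
      \<le> q ^ m * l ^ CARD('n)"
  shows "(\<integral>\<^sup>+x\<in>hcube a l. dist_neg_power E \<alpha> x \<partial>lebesgue)
    \<le> ennreal (\<theta> powr (- \<alpha>) / (1 - \<theta> powr (- \<alpha>) * q)
        * (max_dist E (hcube a l) powr (- \<alpha>) * l ^ CARD('n)))"
proof -
  let ?P = "hcube a l" and ?n = "CARD('n)" and ?w = "dist_neg_power E \<alpha>"
  define S where "S = max_dist E ?P"
  define \<rho> where "\<rho> = \<theta> powr (- \<alpha>)"
  define A where "A m = {x \<in> ?P. infdist x E \<le> \<theta> ^ m * S}" for m
  define v where "v m = S powr (- \<alpha>) * \<rho> ^ Suc m" for m
  have S_pos: "0 < S" using S by (simp add: S_def)
  have \<rho>: "0 < \<rho>" using \<theta> by (simp add: \<rho>_def)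
  have v: "0 \<le> v m" for m using \<rho> by (simp add: v_def)
  have v_eq: "(\<theta> ^ Suc m * S) powr (- \<alpha>) = v m" for m
  proof -
    have "(\<theta> ^ Suc m) powr (- \<alpha>) = \<rho> ^ Suc m"
      unfolding \<rho>_def using \<theta>
      by (simp only: powr_realpow[symmetric] powr_powr powr_gt_zero mult.commute)
    then show ?thesis
      using \<theta> S_pos powr_mult[of "\<theta> ^ Suc m" S "- \<alpha>"] unfolding v_def by simp
  qed
  have A_meas: "A m \<in> lmeasurable" for m
    unfolding A_def by (rule lmeasurable_hcube_Collect) measurable
  have A_le: "measure lebesgue (A m) \<le> q ^ m * l ^ ?n" for m
    using decay[of m] by (simp add: A_def S_def)
  let ?Z = "{x \<in> ?P. infdist x E = 0}"
  have Z_meas: "?Z \<in> lmeasurable" by (rule lmeasurable_hcube_Collect) measurable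
  have "measure lebesgue ?Z \<le> q ^ m * l ^ ?n" for m
  proof -
    have "measure lebesgue ?Z \<le> measure lebesgue (A m)"
      using \<theta> S_pos A_meas Z_meas by (intro measure_mono_fmeasurable) (auto simp: A_def fmeasurableD)
    then show ?thesis using A_le[of m] by linarith
  qed
  moreover have "(\<lambda>m. q ^ m * l ^ ?n) \<longlonglongrightarrow> 0 * l ^ ?n"
    using q by (intro tendsto_mult LIMSEQ_power_zero tendsto_const) auto
  ultimately have "measure lebesgue ?Z \<le> 0" by (intro LIMSEQ_le_const) auto
  then have "measure lebesgue ?Z = 0" by (simp add: order_antisym)
  then have "?Z \<in> null_sets lebesgue" using Z_meas
    by (auto simp: emeasure_eq_measure2 fmeasurableD intro!: null_setsI)
  then have "AE x in lebesgue. x \<notin> ?Z" by (rule AE_not_in)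
  then have "AE x in lebesgue. ?w x * indicator ?P x \<le> (\<Sum>m. ennreal (v m) * indicator (A m) x)"
  proof (rule eventually_mono)
    fix x assume "x \<notin> ?Z"
    show "?w x * indicator ?P x \<le> (\<Sum>m. ennreal (v m) * indicator (A m) x)"
    proof (cases "x \<in> ?P")
      case True
      then have u: "0 < infdist x E" "infdist x E \<le> S"
        using \<open>x \<notin> ?Z\<close> infdist_nonneg[of x E] infdist_le_max_dist[of x a l E]
        by (auto simp: S_def less_le)
      obtain m where m: "\<theta> ^ Suc m * S < infdist x E" "infdist x E \<le> \<theta> ^ m * S"
        using power_bracket[OF \<theta> u] .
      have "?w x \<le> ennreal ((\<theta> ^ Suc m * S) powr (- \<alpha>))"
        using \<alpha> m(1) \<theta> S_pos by (intro dist_neg_power_le) auto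
      also have "\<dots> = (\<Sum>i\<in>{m}. ennreal (v i) * indicator (A i) x)"
        using True m(2) by (simp add: v_eq A_def del: power_Suc)
      also have "\<dots> \<le> (\<Sum>i. ennreal (v i) * indicator (A i) x)"
        by (rule sum_le_suminf) auto
      finally show ?thesis using True by simp
    qed simp
  qed
  then have "(\<integral>\<^sup>+x\<in>?P. ?w x \<partial>lebesgue)
      \<le> (\<integral>\<^sup>+x. (\<Sum>m. ennreal (v m) * indicator (A m) x) \<partial>lebesgue)"
    by (rule nn_integral_mono_AE)
  also have "\<dots> = (\<Sum>m. \<integral>\<^sup>+x. ennreal (v m) * indicator (A m) x \<partial>lebesgue)"
    using A_meas by (intro nn_integral_suminf) (auto simp: fmeasurableD)
  also have "\<dots> = (\<Sum>m. ennreal (v m * measure lebesgue (A m)))"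
    using A_meas v
    by (simp add: nn_integral_cmult_indicator fmeasurableD emeasure_eq_measure2 ennreal_mult)
  also have "\<dots> \<le> (\<Sum>m. ennreal (S powr (- \<alpha>) * \<rho> * l ^ ?n * (\<rho> * q) ^ m))"
  proof (intro suminf_le ennreal_leI)
    fix m
    have "v m * measure lebesgue (A m) \<le> v m * (q ^ m * l ^ ?n)"
      using A_le v by (intro mult_left_mono) auto
    also have "\<dots> = S powr (- \<alpha>) * \<rho> * l ^ ?n * (\<rho> * q) ^ m"
      by (simp add: v_def power_mult_distrib)
    finally show "v m * measure lebesgue (A m) \<le> S powr (- \<alpha>) * \<rho> * l ^ ?n * (\<rho> * q) ^ m" .
  qed auto
  also have "\<dots> = ennreal (\<Sum>m. S powr (- \<alpha>) * \<rho> * l ^ ?n * (\<rho> * q) ^ m)"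
    using \<rho> q l conv by (intro suminf_ennreal2) (auto simp: \<rho>_def[symmetric] abs_mult)
  also have "(\<Sum>m. S powr (- \<alpha>) * \<rho> * l ^ ?n * (\<rho> * q) ^ m)
      = S powr (- \<alpha>) * \<rho> * l ^ ?n * (1 / (1 - \<rho> * q))"
    using \<rho> q conv by (subst suminf_mult) (auto simp: \<rho>_def[symmetric] abs_mult suminf_geometric)
  finally show ?thesis by (simp add: S_def \<rho>_def mult_ac)
qed

lemma compact_subset_hcube:
  fixes K :: "(real ^ 'n) set"
  assumes "compact K"
  obtains a l where "0 < l" "K \<subseteq> hcube a l"
proof -
  obtain r where r: "0 < r" "\<And>x. x \<in> K \<Longrightarrow> norm x \<le> r"
    using compact_imp_bounded[OF assms] unfolding bounded_pos by blast
  have "K \<subseteq> hcube (\<chi> i. - r) (3 * r)"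
  proof
    fix x assume "x \<in> K"
    then have "\<bar>x $ i\<bar> \<le> r" for i using r(2) component_le_norm_cart[of x i] by force
    then have "- r \<le> x $ i \<and> x $ i < - r + 3 * r" for i using r(1) by (smt (verit))
    then show "x \<in> hcube (\<chi> i. - r) (3 * r)" by (simp add: hcube_def)
  qed
  then show ?thesis using that[where l = "3 * r"] r(1) by simp
qed

text \<open>The exponent \<open>\<alpha>\<close> is chosen such that \<open>\<theta>\<^sup>\<alpha> = sqrt (1 - c)\<close>, which makes the ratio of the geometric
  series \<open>sqrt (1 - c) < 1\<close>. The mean over a cube is then at most a constant times
  \<open>S\<^sup>-\<^sup>\<alpha>\<close>, and \<open>S\<^sup>-\<^sup>\<alpha>\<close> is a lower bound for the function on the cube, since no distance there
  exceeds \<open>S\<close>.\<close>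

lemma mostly_distant_imp_muckenhoupt:
  fixes E :: "(real ^ 'n) set"
  assumes "mostly_distant c \<kappa> E" "0 < c" "c < 1" "0 < \<kappa>" "\<kappa> < 1"
  obtains \<alpha> where "0 < \<alpha>" "muckenhoupt_A1 (dist_neg_power E \<alpha>)"
proof -
  let ?n = "CARD('n)"
  obtain \<theta> where \<theta>: "0 < \<theta>" "\<theta> < 1" and decay: "\<And>m a l. 0 < l \<Longrightarrow>
    measure lebesgue {x \<in> hcube a l. infdist x E \<le> \<theta> ^ m * max_dist E (hcube a l)}
      \<le> (1 - c) ^ m * l ^ ?n"
    using mostly_distant_level_set_decay[OF assms] by blast
  define \<alpha> where "\<alpha> = ln (1 - c) / (2 * ln \<theta>)"
  let ?w = "dist_neg_power E \<alpha>"
  have \<alpha>: "0 < \<alpha>" using \<theta> assms by (simp add: \<alpha>_def divide_neg_neg)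
  have conv: "\<theta> powr (- \<alpha>) * (1 - c) < 1"
  proof -
    define y where "y = exp (ln (1 - c) / 2)"
    have "\<theta> powr (- \<alpha>) = inverse y" using \<theta> by (simp add: powr_def \<alpha>_def y_def exp_minus)
    moreover have "1 - c = y * y"
      unfolding y_def exp_add[symmetric] field_sum_of_halves using assms by simp
    moreover have "y \<noteq> 0" by (simp add: y_def)
    ultimately have "\<theta> powr (- \<alpha>) * (1 - c) = y" by simp
    moreover have "y < 1" using assms by (simp add: y_def)
    ultimately show ?thesis by simp
  qed
  define C where "C = \<theta> powr (- \<alpha>) / (1 - \<theta> powr (- \<alpha>) * (1 - c))"
  have C: "0 \<le> C" using conv by (simp add: C_def)
  have S: "0 < max_dist E (hcube a l)" if "0 < l" for a l
    using assms(1) that unfolding mostly_distant_def by blast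
  have integral: "(\<integral>\<^sup>+x\<in>hcube a l. ?w x \<partial>lebesgue)
      \<le> ennreal (C * (max_dist E (hcube a l) powr (- \<alpha>) * l ^ ?n))" if l: "0 < l" for a l
    unfolding C_def using \<theta> assms \<alpha> conv l S decay by (intro nn_integral_dist_neg_power_le) auto
  have "locally_integrable ?w"
    unfolding locally_integrable_def
  proof (intro conjI allI impI measurable_dist_neg_power)
    fix K :: "(real ^ 'n) set" assume "compact K"
    then obtain a l where al: "0 < l" "K \<subseteq> hcube a l" using compact_subset_hcube by blast
    have "(\<integral>\<^sup>+x\<in>K. ?w x \<partial>lebesgue) \<le> (\<integral>\<^sup>+x\<in>hcube a l. ?w x \<partial>lebesgue)"
      using al by (intro nn_integral_mono) (auto simp: indicator_def)
    also have "\<dots> < \<infinity>" using integral[OF al(1)] by (rule order_le_less_trans) simp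
    finally show "(\<integral>\<^sup>+x\<in>K. ?w x \<partial>lebesgue) < \<infinity>" .
  qed
  moreover have "0 < ?w x" for x
    using infdist_nonneg[of x E] by (auto simp: dist_neg_power_def)
  ultimately have "weight ?w" by (simp add: weight_def)
  moreover have "(\<integral>\<^sup>+x\<in>Q. ?w x \<partial>lebesgue) / emeasure lebesgue Q \<le> ennreal C * ess_inf_on Q ?w"
    if "is_cube Q" for Q
  proof -
    obtain a l where l: "0 < l" and Q: "Q = hcube a l" using \<open>is_cube Q\<close> by (auto simp: is_cube_def)
    define S where "S = max_dist E Q"
    have "(\<integral>\<^sup>+x\<in>Q. ?w x \<partial>lebesgue) / emeasure lebesgue Q
        \<le> ennreal (C * (S powr (- \<alpha>) * l ^ ?n)) / ennreal (l ^ ?n)"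
      using integral[OF l, of a] unfolding Q S_def emeasure_hcube[OF l]
      by (rule divide_right_mono_ennreal)
    also have "\<dots> = ennreal C * ennreal (S powr (- \<alpha>))"
      using l C by (simp add: divide_ennreal ennreal_mult[symmetric])
    also have "\<dots> \<le> ennreal C * ess_inf_on Q ?w"
    proof (rule mult_left_mono)
      have "ennreal (S powr (- \<alpha>)) \<le> ?w x" if "x \<in> Q" for x
        using that \<alpha> S[OF l, of a] infdist_le_max_dist[of x a l E]
        by (intro dist_neg_power_ge) (auto simp: Q S_def)
      then show "ennreal (S powr (- \<alpha>)) \<le> ess_inf_on Q ?w"
        unfolding ess_inf_on_def by (intro Sup_upper) auto
    qed simp
    finally show ?thesis .
  qed
  ultimately have "muckenhoupt_A1 ?w" using C unfolding muckenhoupt_A1_def by blast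
  then show ?thesis using that \<alpha> by blast
qed

theorem theorem1p1:
  fixes E :: "(real ^ 'n) set"
  assumes "E \<noteq> {}" and "E \<subset> UNIV"
  shows "(\<exists>\<alpha>>0. muckenhoupt_A1 (dist_neg_power E \<alpha>)) \<longleftrightarrow> weakly_porous E"
proof
  assume "\<exists>\<alpha>>0. muckenhoupt_A1 (dist_neg_power E \<alpha>)"
  then obtain \<alpha> \<kappa> where "0 < \<kappa>" "\<kappa> < 1" "mostly_distant (1 / 2) \<kappa> E"
    using muckenhoupt_imp_mostly_distant by blast
  then show "weakly_porous E"
    by (intro mostly_distant_imp_weakly_porous[OF assms(1), of "1 / 2"]) auto
next
  assume "weakly_porous E"
  then obtain c \<kappa> where "0 < c" "c < 1" "0 < \<kappa>" "\<kappa> < 1" "mostly_distant c \<kappa> E"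
    using weakly_porous_imp_mostly_distant[OF assms(1)] by blast
  then show "\<exists>\<alpha>>0. muckenhoupt_A1 (dist_neg_power E \<alpha>)"
    using mostly_distant_imp_muckenhoupt by blast
qed

end
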